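(* Let $A \subset \mathbb{Q}$ be a finite set with $|AA| \leq K|A|$ for some integer $K$, and let $k \geq 1$ be an integer. Then $$\Lambda_k(A+1) \leq (8k^4)^{K},$$ and in particular $$|(A+1)^{(k)}| \geq \frac{|A|^k}{(8k^4)^{kK}}.$$
   Context: $AA=\{ab: a,b\in A\}$, $A+1=\{a+1: a\in A\}$, and for a finite set $B$, $B^{(k)}=\{b_1\cdots b_k : b_1,\dots,b_k\in B\}$ is the $k$-fold product set. For a finite set $B=\{b_1,\dots,b_N\}$ of numbers and non-negative real weights $w=(w_1,\dots,w_N)$, the weighted multiplicative energy of order $k$ is $E_{k,w}(B)=\sum w_{i_1}\cdots w_{i_{2k}}$, the sum over all $2k$-tuples $(i_1,\dots,i_{2k})\in[N]^{2k}$ with $b_{i_1}\cdots b_{i_k}=b_{i_{k+1}}\cdots b_{i_{2k}}$. Then $\Lambda_k(B)=\max_w E_{k,w}(B)^{1/k}$, the maximum over all non-negative weights with $\sum_{i=1}^N w_i^2=1$.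
   Formalization: The bound on Λ_k(A+1) is proved under the added assumption −1 ∉ A (0 ∉ A+1), without which it fails, e.g. for A = {−1} ∪ {2^i : 1 ≤ i ≤ N}, k = 2, K = 3 and N large; the product set bound is proved for all A. *)

theory Defs
  imports "HOL-Analysis.Analysis"
begin

definition product_set :: "'a::times set \<Rightarrow> 'a set \<Rightarrow> 'a set" where
  "product_set A B = {a * b | a b. a \<in> A \<and> b \<in> B}"

definition shift_one :: "'a::{plus,one} set \<Rightarrow> 'a set" where
  "shift_one A = {a + 1 | a. a \<in> A}"

definition kfold_product_set :: "nat \<Rightarrow> 'a::comm_monoid_mult set \<Rightarrow> 'a set" where
  "kfold_product_set k B = {(\<Prod>i<k. b i) | b. \<forall>i<k. b i \<in> B}"

text \<open>A set of numbers is its own index set: the weights are indexed by the elements of B,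
  and a 2k-tuple is an extensional function from {..<2 * k} to B.\<close>

definition weighted_energy :: "nat \<Rightarrow> ('a::comm_monoid_mult \<Rightarrow> real) \<Rightarrow> 'a set \<Rightarrow> real" where
  "weighted_energy k w B =
     (\<Sum>b \<in> {b \<in> {..<2 * k} \<rightarrow>\<^sub>E B. (\<Prod>i<k. b i) = (\<Prod>i=k..<2 * k. b i)}.
        \<Prod>i<2 * k. w (b i))"

definition unit_weights :: "'a set \<Rightarrow> ('a \<Rightarrow> real) set" where
  "unit_weights B = {w. (\<forall>b\<in>B. 0 \<le> w b) \<and> (\<Sum>b\<in>B. (w b)\<^sup>2) = 1}"

text \<open>The supremum is a maximum (lemma Lambda_const_attained below). The empty set carries no unit
  weights; the value there is set to 0, the supremum of no non-negative numbers.\<close>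

definition Lambda_const :: "nat \<Rightarrow> 'a::comm_monoid_mult set \<Rightarrow> real" where
  "Lambda_const k B =
     (if B = {} then 0 else Sup ((\<lambda>w. root k (weighted_energy k w B)) ` unit_weights B))"

lemma unit_weights_nonempty:
  assumes "finite B" "B \<noteq> {}"
  shows "unit_weights B \<noteq> {}"
proof -
  obtain c where c: "c \<in> B" using assms by blast
  have "(\<Sum>b\<in>B. ((if b = c then 1 else 0)::real)\<^sup>2) = (\<Sum>b\<in>B. if b = c then 1 else 0)"
    by (rule sum.cong) auto
  also have "\<dots> = 1" using assms c by simp
  finally have "(\<lambda>b. if b = c then 1 else 0) \<in> unit_weights B"
    by (simp add: unit_weights_def)
  then show ?thesis by blast
qed

lemma weighted_energy_cong:
  assumes "\<And>b. b \<in> B \<Longrightarrow> w b = w' b"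
  shows "weighted_energy k w B = weighted_energy k w' B"
  unfolding weighted_energy_def
  by (intro sum.cong prod.cong refl assms) auto

lemma Lambda_const_max_aux:
  fixes B :: "'a::comm_monoid_mult set"
  assumes fin: "finite B" and ne: "B \<noteq> {}"
  shows "\<exists>w\<in>unit_weights B. \<forall>v\<in>unit_weights B.
           root k (weighted_energy k v B) \<le> root k (weighted_energy k w B)"
proof -
  define P :: "('a \<Rightarrow> real) set"
    where "P = (\<Pi>\<^sub>E b\<in>UNIV. if b \<in> B then {0..1} else {0})"
  define W where "W = P \<inter> {w. (\<Sum>b\<in>B. (w b)\<^sup>2) = 1}"
  have "compactin (product_topology (\<lambda>_. euclidean) UNIV) P"
    unfolding P_def by (subst compactin_PiE) auto
  then have "compact P" by (simp add: euclidean_product_topology)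
  moreover have "closed {w::'a \<Rightarrow> real. (\<Sum>b\<in>B. (w b)\<^sup>2) = 1}"
    by (intro closed_Collect_eq continuous_intros continuous_on_product_coordinates)
  ultimately have cW: "compact W" unfolding W_def by (rule compact_Int_closed)
  have repr: "\<exists>w\<in>W. \<forall>b\<in>B. w b = v b" if v: "v \<in> unit_weights B" for v
  proof -
    let ?w = "\<lambda>b. if b \<in> B then v b else 0"
    have le1: "v b \<le> 1" if "b \<in> B" for b
    proof -
      have "(v b)\<^sup>2 \<le> (\<Sum>b\<in>B. (v b)\<^sup>2)"
        by (rule member_le_sum) (use that fin in auto)
      then have "(v b)\<^sup>2 \<le> 1\<^sup>2" using v by (simp add: unit_weights_def)
      then show ?thesis by (rule power2_le_imp_le) simp
    qed
    have "?w \<in> W" using v le1 by (auto simp: W_def P_def unit_weights_def)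
    then show ?thesis by (intro bexI[of _ ?w]) auto
  qed
  have sub: "W \<subseteq> unit_weights B"
    by (auto simp: W_def P_def unit_weights_def PiE_iff split: if_splits)
  have "W \<noteq> {}" using repr unit_weights_nonempty[OF fin ne] by blast
  moreover have "continuous_on W (\<lambda>w. root k (weighted_energy k w B))"
    unfolding weighted_energy_def
    by (intro continuous_intros continuous_on_product_coordinates
          continuous_on_subset[OF continuous_on_product_coordinates]) auto
  ultimately obtain w where w: "w \<in> W"
    "\<And>v. v \<in> W \<Longrightarrow> root k (weighted_energy k v B) \<le> root k (weighted_energy k w B)"
    using continuous_attains_sup[OF cW] by blast
  have "root k (weighted_energy k v B) \<le> root k (weighted_energy k w B)"
    if "v \<in> unit_weights B" for v
    using repr[OF that] w(2) weighted_energy_cong[of B v _ k] by metis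
  then show ?thesis using w(1) sub by blast
qed

lemma Lambda_const_attained:
  assumes "finite B" "B \<noteq> {}"
  shows "\<exists>w\<in>unit_weights B. Lambda_const k B = root k (weighted_energy k w B)"
proof -
  obtain w where w: "w \<in> unit_weights B" "\<And>v. v \<in> unit_weights B \<Longrightarrow>
      root k (weighted_energy k v B) \<le> root k (weighted_energy k w B)"
    using Lambda_const_max_aux[OF assms] by blast
  have "Sup ((\<lambda>w. root k (weighted_energy k w B)) ` unit_weights B)
      = root k (weighted_energy k w B)"
    by (rule cSup_eq_maximum) (use w in auto)
  then show ?thesis using w(1) assms(2) by (auto simp: Lambda_const_def)
qed

lemma Lambda_const_upper:
  assumes "finite B" "B \<noteq> {}" "w \<in> unit_weights B"
  shows "root k (weighted_energy k w B) \<le> Lambda_const k B"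
proof -
  have "bdd_above ((\<lambda>w. root k (weighted_energy k w B)) ` unit_weights B)"
    using Lambda_const_max_aux[OF assms(1,2), of k] by (auto simp: bdd_above_def)
  then show ?thesis using assms(2,3) by (auto simp: Lambda_const_def intro: cSup_upper)
qed

end

theory Submission imports Defs "HOL-Library.Real_Mod" begin

text \<open>
  By Freiman's lemma, either A has at most (K+1)^2 elements, and the trivial bound by the cardinality
  is good enough, or the ratios of the nonzero elements of A generate a group of rank d < K, which
  Gaussian elimination separates by the valuations at d primes.

  The energy of order k is the 2k-th power of an L^(2k)-norm on the dual group. If all a have positive
  valuation at p, an equation between two products of numbers 1 + a forces two of the
  valuations to be equal, since the smallest cannot occur only once. By Hoelder's inequality the
  squared norm is then at most 2k^2 times the sum of the squared norms over the classes of
  constant valuation. Split A by the signs of its elements and of their d valuations,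
  at the cost of a factor 3^(d+1). On each part the previous step disposes of the primes with positive
  valuation. Afterwards the remaining primes have negative valuations, where 1 + a and a have the same
  valuation; hence in every solution the products of the a agree, 1 + a may be
  replaced by 1 + 1/a, and the step applies again. In total the constant is 3 (6k^2)^d.
\<close>

subsection \<open>Valuations of rational numbers\<close>

text \<open>Negative valuations resist the argument by smallest valuations, since 1 + a is then not
  a p-adic unit. They only say that the products of the a agree at p, which is of use once the
  agreement holds at every separating prime; hence the primes of positive valuation have to be
  frozen before a is inverted. Squared norms are compared with sums of squared weights because the
  latter add over classes without loss, so the cost of a prime does not depend on the number of its
  classes. Valuations are blind to signs, the torsion of the group: -1 is put into all spans, and
  signs are kept constant on the classes. The element 0 of A + 1 lies outside the group and is
  harmful: once on both sides of an equation, it leaves all other factors free. So -1 is kept out of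
  A for the energy, and discarded at the cost of a factor 2 for the product set. With d <= K - 1 all
  constants fit, as 2 * 3 * (6k^2)^d <= (8k^4)^(d+1), and (K+1)^2 <= 8^K in the trivial
  case.\<close>

definition padic_val :: "nat \<Rightarrow> rat \<Rightarrow> int" where
  "padic_val p q = int (multiplicity (int p) (fst (quotient_of q)))
     - int (multiplicity (int p) (snd (quotient_of q)))"

lemma padic_val_of_int_divide:
  assumes "prime p" "a \<noteq> 0" "b \<noteq> 0"
  shows "padic_val p (of_int a / of_int b)
    = int (multiplicity (int p) a) - int (multiplicity (int p) b)"
proof -
  obtain c d where cd: "quotient_of (of_int a / of_int b) = (c, d)" by fastforce
  have pr: "prime_elem (int p)" using assms by simp
  have d: "d > 0" using quotient_of_denom_pos[OF cd] .
  have "(of_int a / of_int b :: rat) = of_int c / of_int d" using quotient_of_div[OF cd] .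
  then have "(of_int (a * d) :: rat) = of_int (c * b)" using d assms by (simp add: field_simps)
  then have e: "a * d = c * b" by (simp only: of_int_eq_iff)
  with d assms have "c \<noteq> 0" by auto
  have "multiplicity (int p) a + multiplicity (int p) d = multiplicity (int p) c + multiplicity (int p) b"
    using arg_cong[OF e, of "multiplicity (int p)"] pr d assms \<open>c \<noteq> 0\<close>
    by (simp add: prime_elem_multiplicity_mult_distrib)
  then show ?thesis unfolding padic_val_def cd by simp
qed

lemma rat_int_fraction:
  fixes x :: rat
  assumes "x \<noteq> 0"
  obtains a b where "x = of_int a / of_int b" "a \<noteq> 0" "b \<noteq> 0"
proof -
  obtain c d where cd: "quotient_of x = (c, d)" by fastforce
  have "x = of_int c / of_int d" using quotient_of_div[OF cd] .
  moreover from this have "c \<noteq> 0" using assms by force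
  moreover have "d \<noteq> 0" using quotient_of_denom_pos[OF cd] by simp
  ultimately show ?thesis by (rule that)
qed

lemma padic_val_mult:
  assumes "prime p" "x \<noteq> 0" "y \<noteq> 0"
  shows "padic_val p (x * y) = padic_val p x + padic_val p y"
proof -
  obtain a b where x: "x = of_int a / of_int b" "a \<noteq> 0" "b \<noteq> 0" using rat_int_fraction assms by blast
  obtain c d where y: "y = of_int c / of_int d" "c \<noteq> 0" "d \<noteq> 0" using rat_int_fraction assms by blast
  have "x * y = of_int (a * c) / of_int (b * d)" using x y by simp
  then have "padic_val p (x * y) = int (multiplicity (int p) (a * c)) - int (multiplicity (int p) (b * d))"
    using padic_val_of_int_divide[OF assms(1), of "a * c" "b * d"] x y by simp
  then show ?thesis
    using x y assms padic_val_of_int_divide[OF assms(1), of a b] padic_val_of_int_divide[OF assms(1), of c d]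
    by (simp add: prime_elem_multiplicity_mult_distrib)
qed

lemma padic_val_1: "prime p \<Longrightarrow> padic_val p 1 = 0"
  using padic_val_of_int_divide[of p 1 1] by simp

lemma padic_val_minus_1: "prime p \<Longrightarrow> padic_val p (-1) = 0"
  using padic_val_of_int_divide[of p "-1" 1] by (simp add: multiplicity_unit_right)

lemma padic_val_inverse:
  assumes "prime p" "x \<noteq> 0"
  shows "padic_val p (inverse x) = - padic_val p x"
  using padic_val_mult[of p x "inverse x"] padic_val_1[of p] assms by simp

lemma padic_val_divide:
  assumes "prime p" "x \<noteq> 0" "y \<noteq> 0"
  shows "padic_val p (x / y) = padic_val p x - padic_val p y"
  using assms by (simp add: divide_inverse padic_val_mult padic_val_inverse)

lemma padic_val_power:
  assumes "prime p" "x \<noteq> 0"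
  shows "padic_val p (x ^ n) = int n * padic_val p x"
  by (induction n) (use assms in \<open>auto simp: padic_val_1 padic_val_mult algebra_simps\<close>)

lemma padic_val_powi:
  assumes "prime p" "x \<noteq> 0"
  shows "padic_val p (x powi n) = n * padic_val p x"
  using assms by (auto simp: power_int_def padic_val_power padic_val_inverse)

lemma padic_val_prod:
  assumes "prime p" "\<And>i. i \<in> I \<Longrightarrow> f i \<noteq> 0"
  shows "padic_val p (\<Prod>i\<in>I. f i) = (\<Sum>i\<in>I. padic_val p (f i))"
  using assms(2)
  by (induction I rule: infinite_finite_induct) (use assms(1) in \<open>auto simp: padic_val_1 padic_val_mult\<close>)

lemma padic_val_add_ge:
  assumes "prime p" "x \<noteq> 0" "y \<noteq> 0" "x + y \<noteq> 0"
  shows "padic_val p (x + y) \<ge> min (padic_val p x) (padic_val p y)"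
proof -
  obtain a b where x: "x = of_int a / of_int b" "a \<noteq> 0" "b \<noteq> 0" using rat_int_fraction assms by blast
  obtain c d where y: "y = of_int c / of_int d" "c \<noteq> 0" "d \<noteq> 0" using rat_int_fraction assms by blast
  have x': "x = of_int (a * d) / of_int (b * d)" and y': "y = of_int (b * c) / of_int (b * d)"
    using x y by simp_all
  have s: "x + y = of_int (a * d + b * c) / of_int (b * d)"
    using x' y' by (simp add: add_divide_distrib)
  have nz: "a * d + b * c \<noteq> 0" using assms(4) unfolding s by (metis div_0 of_int_0)
  let ?m = "multiplicity (int p)"
  have "int p ^ min (?m (a * d)) (?m (b * c)) dvd a * d + b * c"
    by (intro dvd_add multiplicity_dvd') auto
  then have "min (?m (a * d)) (?m (b * c)) \<le> ?m (a * d + b * c)"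
    using nz assms(1) by (intro multiplicity_geI) auto
  moreover have "padic_val p x = int (?m (a * d)) - int (?m (b * d))"
    unfolding x' using x y by (intro padic_val_of_int_divide assms(1)) auto
  moreover have "padic_val p y = int (?m (b * c)) - int (?m (b * d))"
    unfolding y' using x y by (intro padic_val_of_int_divide assms(1)) auto
  moreover have "padic_val p (x + y) = int (?m (a * d + b * c)) - int (?m (b * d))"
    unfolding s using x y nz by (intro padic_val_of_int_divide assms(1)) auto
  ultimately show ?thesis by linarith
qed

lemma padic_val_nonzero_dvd:
  assumes "padic_val p q \<noteq> 0"
  shows "int p dvd fst (quotient_of q) * snd (quotient_of q)"
proof (rule ccontr)
  assume "\<not> ?thesis"
  then have "\<not> int p dvd fst (quotient_of q)" "\<not> int p dvd snd (quotient_of q)" by auto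
  then show False using assms by (simp add: padic_val_def not_dvd_imp_multiplicity_0)
qed

lemma finite_padic_support:
  assumes "q \<noteq> 0"
  shows "finite {p. prime p \<and> padic_val p q \<noteq> 0}"
proof -
  obtain a b where ab: "quotient_of q = (a, b)" by fastforce
  have "b > 0" "q = of_int a / of_int b"
    using quotient_of_denom_pos[OF ab] quotient_of_div[OF ab] by auto
  then have nz: "a * b \<noteq> 0" using assms by auto
  have "{p. prime p \<and> padic_val p q \<noteq> 0} \<subseteq> {p. p \<le> nat \<bar>a * b\<bar>}"
  proof safe
    fix p assume "padic_val p q \<noteq> 0"
    then have "int p dvd a * b" using padic_val_nonzero_dvd[of p q] ab by simp
    then have "\<bar>int p\<bar> \<le> \<bar>a * b\<bar>" by (intro dvd_imp_le_int nz)
    then show "p \<le> nat \<bar>a * b\<bar>" by linarith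
  qed
  then show ?thesis by (rule finite_subset) simp
qed

text \<open>In lowest terms, a prime that divides the numerator or the denominator divides only one
  of them. Thus the valuations together determine a rational up to sign.\<close>

lemma exists_padic_val_nonzero:
  assumes "q \<noteq> 0" "\<bar>q\<bar> \<noteq> 1"
  shows "\<exists>p. prime p \<and> padic_val p q \<noteq> 0"
proof -
  obtain a b where ab: "quotient_of q = (a, b)" by fastforce
  have b: "b > 0" and cop: "coprime a b" and q: "q = of_int a / of_int b"
    using quotient_of_denom_pos[OF ab] quotient_of_coprime[OF ab] quotient_of_div[OF ab] by auto
  have a: "a \<noteq> 0" using q assms by auto
  have "\<not> (\<bar>a\<bar> = 1 \<and> \<bar>b\<bar> = 1)"
  proof
    assume "\<bar>a\<bar> = 1 \<and> \<bar>b\<bar> = 1"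
    then have "\<bar>q\<bar> = 1" unfolding q by (simp add: flip: of_int_abs)
    then show False using assms(2) by simp
  qed
  then have "\<not> is_unit a \<or> \<not> is_unit b" by simp
  then obtain r where r1: "prime r" "r dvd a \<or> r dvd b"
    using a b prime_divisor_exists[of a] prime_divisor_exists[of b] by (metis less_irrefl)
  moreover have "\<not> (r dvd a \<and> r dvd b)"
    using cop r1(1) coprime_common_divisor not_prime_unit by blast
  ultimately have r: "prime r" "r dvd a \<and> \<not> r dvd b \<or> r dvd b \<and> \<not> r dvd a" by blast+
  have r0: "r \<ge> 0" using r(1) prime_ge_0_int by blast
  have "\<not> is_unit r" using r(1) not_prime_unit by blast
  then have "multiplicity r a > 0 \<longleftrightarrow> r dvd a" "multiplicity r b > 0 \<longleftrightarrow> r dvd b"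
    using a b by (auto intro!: multiplicity_gt_zero_iff)
  then have "multiplicity r a \<noteq> multiplicity r b" using r(2) by linarith
  then have "padic_val (nat r) q \<noteq> 0" unfolding padic_val_def ab using r0 by simp
  moreover have "prime (nat r)" using r(1) r0 by simp
  ultimately show ?thesis by blast
qed

lemma padic_val_shift_one_neg:
  assumes "prime p" "x \<noteq> 0" "1 + x \<noteq> 0" "padic_val p x < 0"
  shows "padic_val p (1 + x) = padic_val p x"
proof (rule antisym)
  \<comment> \<open>Reading x as (1 + x) + (-1): the minimum is at most the negative valuation of x,
    so it cannot be the valuation 0 of -1.\<close>
  have "padic_val p x \<ge> min (padic_val p (1 + x)) (padic_val p (-1))"
    using padic_val_add_ge[of p "1 + x" "-1"] assms by simp
  then show "padic_val p (1 + x) \<le> padic_val p x" using assms padic_val_minus_1 by fastforce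
  show "padic_val p x \<le> padic_val p (1 + x)"
    using padic_val_add_ge[of p 1 x] assms padic_val_1[of p] by auto
qed

text \<open>For n > 0, membership in the group of p-adic units that are 1 modulo p^n. The disjunct
  \<open>x = 1\<close> is there because \<open>padic_val p 0\<close> is 0, where the valuation
  should be infinite.\<close>

definition unit_congruent :: "nat \<Rightarrow> int \<Rightarrow> rat \<Rightarrow> bool" where
  "unit_congruent p n x \<longleftrightarrow> x \<noteq> 0 \<and> padic_val p x = 0 \<and> (x = 1 \<or> padic_val p (x - 1) \<ge> n)"

lemma unit_congruent_1: "prime p \<Longrightarrow> unit_congruent p n 1"
  by (simp add: unit_congruent_def padic_val_1)

lemma unit_congruent_mult:
  assumes "prime p" "unit_congruent p n x" "unit_congruent p n y"
  shows "unit_congruent p n (x * y)"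
proof -
  have nz: "x \<noteq> 0" "y \<noteq> 0" and v: "padic_val p x = 0" "padic_val p y = 0"
    using assms by (auto simp: unit_congruent_def)
  have "x * y = 1 \<or> padic_val p (x * y - 1) \<ge> n"
  proof (cases "x = 1 \<or> y = 1 \<or> x * y = 1")
    case False
    define u v where "u = x * (y - 1)" and "v = x - 1"
    have uv: "x * y - 1 = u + v" by (simp add: u_def v_def algebra_simps)
    have "padic_val p u \<ge> n" "padic_val p v \<ge> n" "u \<noteq> 0" "v \<noteq> 0"
      using False assms nz v by (auto simp: u_def v_def unit_congruent_def padic_val_mult)
    moreover have "u + v \<noteq> 0" using False uv by (metis eq_iff_diff_eq_0)
    ultimately have "n \<le> padic_val p (u + v)"
      using padic_val_add_ge[of p u v] assms(1) by linarith
    then show ?thesis using uv by simp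
  qed (use assms in \<open>auto simp: unit_congruent_def\<close>)
  then show ?thesis using nz v assms(1) by (simp add: unit_congruent_def padic_val_mult)
qed

lemma unit_congruent_inverse:
  assumes "prime p" "unit_congruent p n x"
  shows "unit_congruent p n (inverse x)"
proof (cases "x = 1")
  case False
  have nz: "x \<noteq> 0" using assms by (auto simp: unit_congruent_def)
  have "inverse x - 1 = (-1) * ((x - 1) * inverse x)" using nz by (simp add: field_simps)
  then have "padic_val p (inverse x - 1) = padic_val p (-1) + (padic_val p (x - 1) + padic_val p (inverse x))"
    using assms(1) nz False padic_val_mult[of p "-1" "(x - 1) * inverse x"]
    by (simp add: padic_val_mult)
  then show ?thesis using assms nz False
    by (simp add: unit_congruent_def padic_val_minus_1 padic_val_inverse)
qed (use assms in simp)

lemma unit_congruent_prod: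
  assumes "prime p" "\<And>i. i \<in> I \<Longrightarrow> unit_congruent p n (f i)"
  shows "unit_congruent p n (\<Prod>i\<in>I. f i)"
  using assms(2)
  by (induction I rule: infinite_finite_induct)
    (use assms(1) in \<open>auto simp: unit_congruent_1 unit_congruent_mult\<close>)

lemma unit_congruent_one_plus:
  assumes "prime p" "x \<noteq> 0" "1 + x \<noteq> 0" "padic_val p x \<ge> n" "padic_val p x > 0"
  shows "unit_congruent p n (1 + x)"
proof -
  have "padic_val p (1 + x) \<ge> 0"
    using padic_val_add_ge[of p 1 x] assms padic_val_1[of p] by auto
  \<comment> \<open>Otherwise 1 = (1 + x) + (-x) would have positive valuation.\<close>
  moreover have "\<not> padic_val p (1 + x) > 0"
  proof
    assume "padic_val p (1 + x) > 0"
    moreover have "padic_val p (- x) = padic_val p x"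
      using padic_val_mult[of p "-1" x] assms padic_val_minus_1[of p] by simp
    ultimately show False
      using padic_val_add_ge[of p "1 + x" "- x"] assms padic_val_1[of p] by auto
  qed
  ultimately show ?thesis using assms by (simp add: unit_congruent_def)
qed

text \<open>If the smallest valuation were attained only once, that single factor would be congruent
  to 1 modulo a higher power of p than it is.\<close>

lemma shifted_products_equal_valuations:
  assumes "prime p" "I \<inter> J = {}" "finite I" "finite J" "I \<union> J \<noteq> {}"
    and a: "\<And>i. i \<in> I \<union> J \<Longrightarrow> a i \<noteq> 0 \<and> 1 + a i \<noteq> 0 \<and> padic_val p (a i) > 0"
    and eq: "(\<Prod>i\<in>I. 1 + a i) = (\<Prod>i\<in>J. 1 + a i)"
  shows "\<exists>s\<in>I \<union> J. \<exists>t\<in>I \<union> J. s \<noteq> t \<and> padic_val p (a s) = padic_val p (a t)"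
proof (rule ccontr)
  assume neg: "\<not> ?thesis"
  \<comment> \<open>I, J and s are generalised so that the case of the minimum lying in J follows by
    exchanging the two sides.\<close>
  have False if "s \<in> I" "I \<inter> J = {}" "finite I" "finite J"
    and a: "\<And>i. i \<in> I \<union> J \<Longrightarrow> a i \<noteq> 0 \<and> 1 + a i \<noteq> 0 \<and> padic_val p (a i) > 0"
    and eq: "(\<Prod>i\<in>I. 1 + a i) = (\<Prod>i\<in>J. 1 + a i)"
    and less: "\<And>t. t \<in> I \<union> J \<Longrightarrow> t \<noteq> s \<Longrightarrow> padic_val p (a s) < padic_val p (a t)" for I J s
  proof -
    \<comment> \<open>The strictness of the minimum is what allows the \<open>+ 1\<close>: all
      factors but the one at s are 1 modulo this higher power of p.\<close>
    let ?n = "padic_val p (a s) + 1"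
    have u: "unit_congruent p ?n (1 + a t)" if "t \<in> I \<union> J" "t \<noteq> s" for t
      using less[OF that] a[OF that(1)] assms(1) by (intro unit_congruent_one_plus) simp_all
    have "(1 + a s) * (\<Prod>i\<in>I - {s}. 1 + a i) = (\<Prod>i\<in>J. 1 + a i)"
      using prod.remove[OF that(3,1), of "\<lambda>i. 1 + a i"] eq by (rule trans[OF sym])
    moreover have "(\<Prod>i\<in>I - {s}. 1 + a i) \<noteq> 0"
      using a that(3) by (subst prod_zero_iff) blast+
    ultimately have eqs: "1 + a s = (\<Prod>i\<in>J. 1 + a i) * inverse (\<Prod>i\<in>I - {s}. 1 + a i)"
      by (metis divide_inverse nonzero_eq_divide_eq)
    have "unit_congruent p ?n (\<Prod>i\<in>J. 1 + a i)"
      by (intro unit_congruent_prod assms(1) u) (use that(1,2) in auto)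
    moreover have "unit_congruent p ?n (\<Prod>i\<in>I - {s}. 1 + a i)"
      by (intro unit_congruent_prod assms(1) u) auto
    ultimately have "unit_congruent p ?n (1 + a s)"
      unfolding eqs by (intro unit_congruent_mult unit_congruent_inverse assms(1))
    then show False using a[of s] that(1) by (simp add: unit_congruent_def)
  qed note * = this
  have fin: "finite (I \<union> J)" using assms(3,4) by simp
  define s where "s = arg_min_on (\<lambda>i. padic_val p (a i)) (I \<union> J)"
  have s: "s \<in> I \<union> J" "\<And>t. t \<in> I \<union> J \<Longrightarrow> padic_val p (a s) \<le> padic_val p (a t)"
    unfolding s_def using arg_min_if_finite(1)[OF fin assms(5)]
      arg_min_least[OF fin assms(5), of _ "\<lambda>i. padic_val p (a i)"] by blast+
  have less: "padic_val p (a s) < padic_val p (a t)" if "t \<in> I \<union> J" "t \<noteq> s" for t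
  proof -
    have "padic_val p (a s) \<noteq> padic_val p (a t)"
      using neg[unfolded bex_simps, rule_format, OF s(1) that(1)] that(2) by simp
    then show ?thesis using s(2)[OF that(1)] by simp
  qed
  show False
  proof (cases "s \<in> I")
    case True
    show ?thesis by (rule *[OF True assms(2-4) a eq less])
  next
    case False
    then have "s \<in> J" using s by blast
    then show ?thesis
    proof (rule *)
      show "J \<inter> I = {}" "finite J" "finite I" using assms(2-4) by blast+
      show "(\<Prod>i\<in>J. 1 + a i) = (\<Prod>i\<in>I. 1 + a i)" using eq by (rule sym)
      show "a i \<noteq> 0 \<and> 1 + a i \<noteq> 0 \<and> padic_val p (a i) > 0" if "i \<in> J \<union> I" for i
        using a that by blast
      show "padic_val p (a s) < padic_val p (a t)" if "t \<in> J \<union> I" "t \<noteq> s" for t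
        using less that by blast
    qed
  qed
qed

subsection \<open>Freiman's lemma\<close>

text \<open>If 0 is not in T, these are the nonzero rationals whose exponent vectors lie in the
  Q-linear span of those of T; \<open>root\<close> is division by a nonzero integer. Closure under
  roots makes elimination with cleared denominators reversible.\<close>

inductive_set mult_span :: "rat set \<Rightarrow> rat set" for T :: "rat set" where
  one: "1 \<in> mult_span T"
| minus_one: "-1 \<in> mult_span T"
| gen: "t \<in> T \<Longrightarrow> t \<in> mult_span T"
| mult: "x \<in> mult_span T \<Longrightarrow> y \<in> mult_span T \<Longrightarrow> x * y \<in> mult_span T"
| inverse: "x \<in> mult_span T \<Longrightarrow> inverse x \<in> mult_span T"
| root: "x powi m \<in> mult_span T \<Longrightarrow> m \<noteq> 0 \<Longrightarrow> x \<in> mult_span T"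

lemma mult_span_divide: "x \<in> mult_span T \<Longrightarrow> y \<in> mult_span T \<Longrightarrow> x / y \<in> mult_span T"
  unfolding divide_inverse by (intro mult_span.mult mult_span.inverse)

lemma mult_span_uminus: "x \<in> mult_span T \<Longrightarrow> - x \<in> mult_span T"
  using mult_span.mult[OF mult_span.minus_one, of x] by simp

lemma mult_span_abs_iff: "\<bar>x\<bar> \<in> mult_span T \<longleftrightarrow> x \<in> mult_span T"
  using mult_span_uminus[of x] mult_span_uminus[of "- x"] by (auto simp: abs_if)

lemma mult_span_prod: "(\<And>i. i \<in> I \<Longrightarrow> f i \<in> mult_span T) \<Longrightarrow> (\<Prod>i\<in>I. f i) \<in> mult_span T"
  by (induction I rule: infinite_finite_induct) (auto intro: mult_span.one mult_span.mult)

lemma mult_span_subset: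
  assumes "T \<subseteq> mult_span U"
  shows "mult_span T \<subseteq> mult_span U"
proof
  fix x assume "x \<in> mult_span T"
  then show "x \<in> mult_span U"
    by induction (use assms in \<open>auto intro: mult_span.intros\<close>)
qed

lemma mult_span_nonzero:
  assumes "0 \<notin> T" "x \<in> mult_span T"
  shows "x \<noteq> 0"
  using assms(2) by induction (use assms(1) in auto)

text \<open>One pivot step with pivot g in column p, denominators cleared: q is sent to q^v(g) /
  g^v(q), v being the valuation at p. The map is multiplicative, sends g to 1, and its values have
  valuation 0 at p.\<close>

lemma mult_span_eliminate:
  assumes p: "prime p" and nz: "0 \<notin> insert g T" and q: "q \<in> mult_span (insert g T)"
  shows "q powi padic_val p g / g powi padic_val p q
    \<in> mult_span ((\<lambda>t. t powi padic_val p g / g powi padic_val p t) ` T)"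
  using q
proof induction
  case one
  then show ?case using p by (simp add: padic_val_1 mult_span.one)
next
  case minus_one
  have "(-1 :: rat) powi padic_val p g = 1 \<or> (-1 :: rat) powi padic_val p g = -1"
    by (simp add: power_int_minus_one_minus power_int_def minus_one_power_iff)
  then show ?case using p by (auto simp: padic_val_minus_1 intro: mult_span.intros)
next
  case (gen t)
  then show ?case using nz by (auto intro: mult_span.gen mult_span.one)
next
  case (mult x y)
  have "x \<noteq> 0" "y \<noteq> 0" using mult_span_nonzero[OF nz] mult by auto
  moreover have "g \<noteq> 0" using nz by auto
  ultimately have "(x * y) powi padic_val p g / g powi padic_val p (x * y)
    = (x powi padic_val p g / g powi padic_val p x) * (y powi padic_val p g / g powi padic_val p y)"
    using p by (simp add: padic_val_mult power_int_mult_distrib power_int_add)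
  then show ?case using mult_span.mult[OF mult.IH] by simp
next
  case (inverse x)
  have "x \<noteq> 0" using mult_span_nonzero[OF nz] inverse by auto
  moreover have "g \<noteq> 0" using nz by auto
  ultimately have "inverse x powi padic_val p g / g powi padic_val p (inverse x)
    = inverse (x powi padic_val p g / g powi padic_val p x)"
    using p by (simp add: padic_val_inverse power_int_inverse power_int_minus divide_inverse)
  then show ?case using mult_span.inverse[OF inverse.IH] by simp
next
  case (root x m)
  have "x \<noteq> 0" using mult_span_nonzero[OF nz] root by fastforce
  moreover have "g \<noteq> 0" using nz by auto
  ultimately have "(x powi m) powi padic_val p g / g powi padic_val p (x powi m)
    = (x powi padic_val p g / g powi padic_val p x) powi m"
    using p by (simp add: padic_val_powi power_int_divide_distrib mult.commute flip: power_int_mult)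
  then show ?case using mult_span.root[OF _ root.hyps(2)] root.IH by simp
qed

text \<open>Gaussian elimination on the exponent vectors.\<close>

lemma mult_span_separating_primes:
  assumes "finite T" "0 \<notin> T"
  shows "\<exists>S. finite S \<and> card S \<le> card T \<and> (\<forall>p\<in>S. prime p) \<and>
    (\<forall>q\<in>mult_span T. (\<forall>p\<in>S. padic_val p q = 0) \<longrightarrow> \<bar>q\<bar> = 1)"
  using assms
proof (induction "card T" arbitrary: T rule: less_induct)
  case less
  show ?case
  proof (cases "T \<subseteq> {1, -1}")
    case True
    have "\<bar>q\<bar> = 1" if "q \<in> mult_span T" for q
      using that
    proof induction
      case (root x m)
      then have x: "\<bar>x\<bar> powi m = 1" by (simp add: power_int_abs)
      have "x \<noteq> 0" using root by auto
      show ?case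
      proof (rule ccontr)
        assume neq: "\<bar>x\<bar> \<noteq> 1"
        then obtain p where "prime p" "padic_val p x \<noteq> 0"
          using exists_padic_val_nonzero[of x] \<open>x \<noteq> 0\<close> by blast
        \<comment> \<open>A nonzero valuation is only multiplied by m, so it survives in the power,
          which is 1 or -1.\<close>
        then have "padic_val p (x powi m) \<noteq> 0" using \<open>x \<noteq> 0\<close> root by (simp add: padic_val_powi)
        moreover have "x powi m = 1 \<or> x powi m = -1" using root.IH by (auto simp: abs_if split: if_splits)
        ultimately show False using \<open>prime p\<close> padic_val_1 padic_val_minus_1 by metis
      qed
    qed (use True in \<open>auto simp: abs_mult\<close>)
    then show ?thesis by (intro exI[of _ "{}"]) auto
  next
    case False
    then obtain g where g: "g \<in> T" "g \<noteq> 1" "g \<noteq> -1" by blast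
    then have "g \<noteq> 0" "\<bar>g\<bar> \<noteq> 1" using less.prems by (auto simp: abs_if split: if_splits)
    then obtain p where p: "prime p" "padic_val p g \<noteq> 0" using exists_padic_val_nonzero by blast
    define U where "U = T - {g}"
    have T: "T = insert g U" "finite U" "g \<notin> U" using g less.prems by (auto simp: U_def)
    define H where "H = (\<lambda>t. t powi padic_val p g / g powi padic_val p t) ` U"
    have cH: "card H \<le> card U" unfolding H_def using T by (intro card_image_le)
    then have "card H < card T" using T by simp
    moreover have "finite H" "0 \<notin> H" using T less.prems \<open>g \<noteq> 0\<close> by (auto simp: H_def)
    ultimately obtain S where S: "finite S" "card S \<le> card H" "\<forall>p\<in>S. prime p"
      "\<forall>q\<in>mult_span H. (\<forall>p\<in>S. padic_val p q = 0) \<longrightarrow> \<bar>q\<bar> = 1"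
      using less.hyps[of H] by (elim exE conjE meta_impE) simp_all
    have "\<bar>q\<bar> = 1" if q: "q \<in> mult_span T" "\<forall>r\<in>insert p S. padic_val r q = 0" for q
    proof -
      have "q powi padic_val p g / g powi padic_val p q \<in> mult_span H"
        using mult_span_eliminate[OF p(1), of g U q] q(1) T less.prems by (simp add: H_def)
      \<comment> \<open>Since q has valuation 0 at p, the denominator is g to the power 0. The
        remaining exponent is nonzero by the choice of p, so the \<open>root\<close> rule recovers
        q.\<close>
      then have "q powi padic_val p g \<in> mult_span H" using q(2) by simp
      then have "q \<in> mult_span H" using p(2) mult_span.root by blast
      then show ?thesis using S(4) q(2) by blast
    qed
    moreover have "card (insert p S) \<le> card T"
      using card_insert_le_m1[of "card T" S p] S cH T by (simp add: card_insert_if)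
    ultimately show ?thesis using S p by (intro exI[of _ "insert p S"]) auto
  qed
qed

text \<open>A lies in a single coset of the span of T, so \<open>card T\<close> bounds the rank of
  the group of ratios. Rank at least d is expressed below by \<open>d \<le> card T\<close> for all
  such T, which avoids a theory of dimension.\<close>

definition ratios_spanned :: "rat set \<Rightarrow> rat set \<Rightarrow> bool" where
  "ratios_spanned A T \<longleftrightarrow> finite T \<and> 0 \<notin> T \<and> (\<forall>a\<in>A. \<forall>b\<in>A. a / b \<in> mult_span T)"

lemma ratios_spannedI:
  assumes "finite T" "0 \<notin> T" "x \<noteq> 0" "\<And>a. a \<in> A \<Longrightarrow> a / x \<in> mult_span T"
  shows "ratios_spanned A T"
proof -
  have "a / b \<in> mult_span T" if "a \<in> A" "b \<in> A" for a b
  proof -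
    have "a / b = (a / x) / (b / x)" using assms(3) by simp
    then show ?thesis using assms(4) that by (metis mult_span_divide)
  qed
  then show ?thesis using assms by (auto simp: ratios_spanned_def)
qed

text \<open>An element of B that is a product of two elements of B is a product of smaller ones.\<close>

lemma indecomposables_span:
  fixes B :: "rat set"
  assumes "finite B" "\<And>b. b \<in> B \<Longrightarrow> b > 1"
  shows "B \<subseteq> mult_span {b \<in> B. \<not> (\<exists>c\<in>B. \<exists>d\<in>B. b = c * d)}" (is "_ \<subseteq> mult_span ?I")
proof
  fix b assume "b \<in> B"
  then show "b \<in> mult_span ?I"
  proof (induction "card {c \<in> B. c < b}" arbitrary: b rule: less_induct)
    case less
    show ?case
    proof (cases "b \<in> ?I")
      case False
      then obtain c d where cd: "c \<in> B" "d \<in> B" "b = c * d" using less.prems by blast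
      have lt: "c < b" "d < b" using cd assms(2)[of c] assms(2)[of d] by auto
      have mono: "card {x \<in> B. x < c} < card {x \<in> B. x < b}" if "c \<in> B" "c < b" for c
        by (rule psubset_card_mono) (use assms(1) that in auto)
      have "c \<in> mult_span ?I" "d \<in> mult_span ?I"
        using less.hyps[OF mono] cd lt by auto
      then show ?thesis unfolding cd(3) by (rule mult_span.mult)
    qed (rule mult_span.gen)
  qed
qed

lemma finite_product_set:
  assumes "finite A" "finite B"
  shows "finite (product_set A B)"
proof -
  have "product_set A B = (\<lambda>(a, b). a * b) ` (A \<times> B)" by (auto simp: product_set_def)
  then show ?thesis using assms by simp
qed

text \<open>Freiman's lemma for the multiplicative group of the rationals. Elements of largest absolute
  value are removed; a product of such an element x with y is new when x/y is indecomposable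
  among the ratios x/A, and the indecomposable ratios span. Signs are the reason for
  the error term being twice the usual one.\<close>

lemma freiman_product_set:
  assumes "finite A" "0 \<notin> A" "\<And>T. ratios_spanned A T \<Longrightarrow> d \<le> card T"
  shows "int (card (product_set A A)) \<ge> (int d + 1) * int (card A) - int d * (int d + 1)"
  using assms
proof (induction "card A" arbitrary: A d rule: less_induct)
  case less
  note finA = less.prems(1)
  show ?case
  proof (cases "A = {}")
    case True
    have "- (int d * (int d + 1)) \<le> 0" by simp
    also have "0 \<le> int (card (product_set A A))" by simp
    finally show ?thesis using True by simp
  next
    case False
    define m where "m = Max (abs ` A)"
    have "m \<in> abs ` A" unfolding m_def using finA False by (intro Max_in) auto
    then obtain x where x: "x \<in> A" "\<bar>x\<bar> = m" by auto
    have le: "\<bar>a\<bar> \<le> m" if "a \<in> A" for a unfolding m_def using finA that by (intro Max_ge) auto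
    have x0: "x \<noteq> 0" and m0: "m > 0" using x less.prems(2) by auto
    define F where "F = {a \<in> A. \<bar>a\<bar> = m}"
    define A' where "A' = A - F"
    have finF: "finite F" "finite A'" using finA by (auto simp: F_def A'_def)
    have xF: "x \<in> F" using x by (simp add: F_def)
    \<comment> \<open>The absolute value cannot tell x from -x, so one or two elements leave at a
      time.\<close>
    have "F \<subseteq> {x, -x}" using x by (auto simp: F_def abs_if split: if_splits)
    then have cF: "card F \<le> 2" using card_mono[of "{x, -x}" F] card_insert_le_m1[of 2 "{-x}" x] by simp
    have F0: "card F > 0" using xF finF card_gt_0_iff by blast
    have cA: "card A = card A' + card F"
      using finA by (simp add: A'_def F_def card_Diff_subset card_mono)
    have lt: "\<bar>a\<bar> < m" "a \<in> A" "a \<noteq> 0" if "a \<in> A'" for a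
      using that le[of a] less.prems(2) by (auto simp: A'_def F_def)
    have sub: "product_set A' A' \<subseteq> product_set A A"
      by (auto simp: product_set_def A'_def)
    have finP: "finite (product_set A A)" "finite (product_set A' A')"
      using finA finF by (auto intro: finite_product_set)
    have top: "u * v \<notin> product_set A' A'" if "u \<in> F" "v \<in> F" for u v
    proof
      assume "u * v \<in> product_set A' A'"
      then obtain a b where ab: "a \<in> A'" "b \<in> A'" "u * v = a * b" by (auto simp: product_set_def)
      then have "m * m = \<bar>a\<bar> * \<bar>b\<bar>" using that by (metis (mono_tags, lifting) F_def abs_mult mem_Collect_eq)
      moreover have "\<bar>a\<bar> * \<bar>b\<bar> < m * m" using lt(1)[OF ab(1)] lt(1)[OF ab(2)] by (intro mult_strict_mono') auto
      ultimately show False by simp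
    qed
    have new: "card (product_set A A) \<ge> card (product_set A' A') + card N"
      if "N \<subseteq> product_set A A" "N \<inter> product_set A' A' = {}" for N
    proof -
      have "card (product_set A' A' \<union> N) \<le> card (product_set A A)"
        using that sub finP by (intro card_mono) auto
      moreover have "finite N" using that finP finite_subset by blast
      ultimately show ?thesis using that finP by (subst (asm) card_Un_disjoint) auto
    qed
    have IH: "int (card (product_set A' A')) \<ge> (int e + 1) * int (card A') - int e * (int e + 1)"
      if "\<And>T. ratios_spanned A' T \<Longrightarrow> e \<le> card T" for e
      by (rule less.hyps) (use cA F0 finF less.prems(2) that in \<open>auto simp: A'_def\<close>)
    show ?thesis
    \<comment> \<open>If A' still has rank at least d, each element of F has at least d + 1 new
      products. Otherwise the rank drops, and x times every element of A is new.\<close>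
    proof (cases "\<exists>T. ratios_spanned A' T \<and> card T < d")
      case False
      define B where "B = (\<lambda>y. m / \<bar>y\<bar>) ` A'"
      define I where "I = {b \<in> B. \<not> (\<exists>c\<in>B. \<exists>d\<in>B. b = c * d)}"
      have B1: "b > 1" if "b \<in> B" for b using that lt by (auto simp: B_def)
      have finI: "finite B" "finite I" using finF by (auto simp: B_def I_def)
      have "ratios_spanned A I"
      proof (rule ratios_spannedI[where x = x])
        show "0 \<notin> I" using B1 by (force simp: I_def)
        show "a / x \<in> mult_span I" if "a \<in> A" for a
        proof (cases "a \<in> F")
          case True
          then have "\<bar>a / x\<bar> = 1" using x m0 by (simp add: F_def)
          then show ?thesis using mult_span.one mult_span_abs_iff by metis
        next
          case False
          then have "m / \<bar>a\<bar> \<in> B" using that by (auto simp: B_def A'_def)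
          then have "m / \<bar>a\<bar> \<in> mult_span I" using indecomposables_span[of B] finI B1 unfolding I_def by blast
          then have "inverse (m / \<bar>a\<bar>) \<in> mult_span I" by (rule mult_span.inverse)
          moreover have "inverse (m / \<bar>a\<bar>) = \<bar>a / x\<bar>" using x by simp
          ultimately show ?thesis using mult_span_abs_iff by metis
        qed
      qed (use finI x0 in auto)
      then have dI: "d \<le> card I" by (rule less.prems(3))
      obtain y where y: "\<And>b. b \<in> I \<Longrightarrow> y b \<in> A' \<and> b = m / \<bar>y b\<bar>"
        using bchoice[of I "\<lambda>b y. y \<in> A' \<and> b = m / \<bar>y\<bar>"] by (auto simp: I_def B_def)
      \<comment> \<open>The ratio 1 stands for x itself and contributes the products of F with x,
        one more for each element of F than the indecomposable ratios give.\<close>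
      define z where "z = y(1 := x)"
      have "1 \<notin> I" using B1 by (force simp: I_def)
      have z: "z b \<in> A \<and> z b \<noteq> 0 \<and> b = m / \<bar>z b\<bar>" if "b \<in> insert 1 I" for b
        using that y[of b] lt[of "y b"] x m0 x0 \<open>1 \<notin> I\<close> by (auto simp: z_def)
      define N where "N = (\<lambda>(u, b). u * z b) ` (F \<times> insert 1 I)"
      have "inj_on (\<lambda>(u, b). u * z b) (F \<times> insert 1 I)"
      proof (rule inj_onI, clarify)
        fix u b v c assume *: "u \<in> F" "v \<in> F" "b \<in> insert 1 I" "c \<in> insert 1 I" "u * z b = v * z c"
        have "\<bar>u\<bar> * \<bar>z b\<bar> = \<bar>v\<bar> * \<bar>z c\<bar>" using *(5) by (metis abs_mult)
        then have "\<bar>z b\<bar> = \<bar>z c\<bar>" using * m0 by (simp add: F_def)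
        then have "b = c" using z[OF *(3)] z[OF *(4)] by metis
        then show "u = v \<and> b = c" using * z[OF *(3)] by simp
      qed
      then have cN: "card N = card F * (card I + 1)"
        unfolding N_def using finI \<open>1 \<notin> I\<close> by (simp add: card_image card_cartesian_product)
      have "N \<subseteq> product_set A A" using z by (force simp: N_def product_set_def F_def)
      moreover have "N \<inter> product_set A' A' = {}"
      proof (intro equals0I)
        fix w assume "w \<in> N \<inter> product_set A' A'"
        then obtain u b a c where w: "u \<in> F" "b \<in> insert 1 I" "a \<in> A'" "c \<in> A'" "u * z b = a * c"
          by (auto simp: N_def product_set_def)
        have "b \<noteq> 1" using top[OF w(1) xF] w by (auto simp: z_def product_set_def)
        then have bI: "b \<in> I" using w by simp
        have "m * \<bar>z b\<bar> = \<bar>a\<bar> * \<bar>c\<bar>" using w(1,5) by (metis (mono_tags, lifting) F_def abs_mult mem_Collect_eq)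
        moreover have "b = m / \<bar>z b\<bar>" "z b \<noteq> 0" using z[OF w(2)] by auto
        moreover have "a \<noteq> 0" "c \<noteq> 0" using lt w by auto
        \<comment> \<open>From b = m / |z b| and m |z b| = |a| |c|, the number b is m^2 / (|a| |c|),
          a product of two ratios, against indecomposability.\<close>
        ultimately have "b = (m / \<bar>a\<bar>) * (m / \<bar>c\<bar>)" using m0
          by (smt (verit, best) abs_zero abs_eq_0 mult.commute nonzero_mult_divide_mult_cancel_left times_divide_times_eq)
        then show False using bI w by (auto simp: I_def B_def)
      qed
      ultimately have "card (product_set A A) \<ge> card (product_set A' A') + card F * (card I + 1)"
        using new cN by metis
      moreover have "card F * (d + 1) \<le> card F * (card I + 1)" using dI by simp
      ultimately have "card (product_set A A) \<ge> card (product_set A' A') + card F * (d + 1)" by linarith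
      then have "int (card (product_set A A)) \<ge> int (card (product_set A' A')) + int (card F) * (int d + 1)"
        by (metis of_nat_1 of_nat_add of_nat_le_iff of_nat_mult)
      then show ?thesis using IH[of d] False cA by (force simp: algebra_simps)
    next
      case True
      then obtain T where T: "ratios_spanned A' T" "card T < d" by blast
      obtain a0 where a0: "a0 \<in> A'"
      proof (cases "A' = {}")
        case True
        have "ratios_spanned A {}"
        proof (rule ratios_spannedI[where x = x])
          show "a / x \<in> mult_span {}" if "a \<in> A" for a
          proof -
            have "\<bar>a / x\<bar> = 1" using that True x m0 by (auto simp: A'_def F_def)
            then show ?thesis using mult_span.one mult_span_abs_iff by metis
          qed
        qed (use x0 in auto)
        then show ?thesis using less.prems(3) T by fastforce
      qed (use that in blast)
      note a0' = lt[OF a0]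
      \<comment> \<open>The single generator x / a0 leads from the ratios of A' to those of A, so
        the rank drops by at most one.\<close>
      have e: "d - 1 \<le> card U" if U: "ratios_spanned A' U" for U
      proof -
        have "ratios_spanned A (insert (x / a0) U)"
        proof (rule ratios_spannedI[where x = a0])
          show "a / a0 \<in> mult_span (insert (x / a0) U)" if "a \<in> A" for a
          proof (cases "a \<in> F")
            case True
            then have "\<bar>a / a0\<bar> = \<bar>x / a0\<bar>" using x by (simp add: F_def)
            moreover have "x / a0 \<in> mult_span (insert (x / a0) U)" by (rule mult_span.gen) simp
            ultimately show ?thesis using mult_span_abs_iff by metis
          next
            case False
            then have "a / a0 \<in> mult_span U" using that U a0 by (auto simp: ratios_spanned_def A'_def)
            moreover have "mult_span U \<subseteq> mult_span (insert (x / a0) U)"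
              by (intro mult_span_subset) (auto intro: mult_span.gen)
            ultimately show ?thesis by blast
          qed
        qed (use U a0' x0 in \<open>auto simp: ratios_spanned_def\<close>)
        then have "d \<le> card (insert (x / a0) U)" by (rule less.prems(3))
        also have "\<dots> \<le> card U + 1" using U by (simp add: ratios_spanned_def card_insert_if)
        finally show ?thesis by simp
      qed
      define N where "N = (*) x ` A"
      have cN: "card N = card A" unfolding N_def using x0 by (intro card_image inj_onI) auto
      have "N \<subseteq> product_set A A" using x by (auto simp: N_def product_set_def)
      moreover have "N \<inter> product_set A' A' = {}"
      proof (intro equals0I)
        fix w assume "w \<in> N \<inter> product_set A' A'"
        then obtain b u v where w: "b \<in> A" "u \<in> A'" "v \<in> A'" "x * b = u * v"
          by (auto simp: N_def product_set_def)
        have "b \<notin> F" using top[OF xF] w by (auto simp: product_set_def)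
        then have b: "b \<in> A'" using w by (simp add: A'_def)
        \<comment> \<open>An old product would make x / u a ratio of A', and then T, with fewer than
          d elements, would span the ratios of A.\<close>
        have "x / u = v / b" using w(4) lt[OF b] lt[OF w(2)] by (simp add: field_simps)
        then have xu: "x / u \<in> mult_span T" using T(1) b w by (auto simp: ratios_spanned_def)
        have "ratios_spanned A T"
        proof (rule ratios_spannedI[where x = u])
          show "a / u \<in> mult_span T" if "a \<in> A" for a
          proof (cases "a \<in> F")
            case True
            then have "\<bar>a / u\<bar> = \<bar>x / u\<bar>" using x by (simp add: F_def)
            then show ?thesis using mult_span_abs_iff xu by metis
          next
            case False
            then show ?thesis using that T(1) w by (auto simp: ratios_spanned_def A'_def)
          qed
        qed (use T lt[OF w(2)] in \<open>auto simp: ratios_spanned_def\<close>)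
        then show False using less.prems(3) T(2) by fastforce
      qed
      ultimately have "card (product_set A A) \<ge> card (product_set A' A') + card A"
        using new cN by metis
      moreover have "int (card (product_set A' A')) \<ge> int d * int (card A') - (int d - 1) * int d"
        using IH[OF e] T(2) by simp
      \<comment> \<open>The error terms d(d+1) and (d-1)d differ by 2d, which is the loss caused by
        up to two removed elements.\<close>
      moreover have "int d * int (card F) \<le> int d * 2" using cF by (intro mult_left_mono) auto
      ultimately show ?thesis using cA by (simp add: algebra_simps)
    qed
  qed
qed

subsection \<open>Mixed energies and Hoelder's inequality\<close>

lemma sum_cis_multiples:
  assumes "\<bar>v\<bar> < int M"
  shows "(\<Sum>t<M. cis (2 * pi * real t * real_of_int v / real M)) = (if v = 0 then of_nat M else 0)"
proof (cases "v = 0")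
  case False
  have M: "M > 0" using assms by linarith
  define z where "z = cis (2 * pi * real_of_int v / real M)"
  have pw: "z ^ t = cis (2 * pi * real t * real_of_int v / real M)" for t
    by (simp only: z_def Complex.DeMoivre) (simp add: mult_ac)
  have "z \<noteq> 1"
  proof
    assume "z = 1"
    then obtain n where "2 * pi * real_of_int v / real M = of_int n * (2 * pi)"
      unfolding z_def cis_eq_1_iff by blast
    then have "real_of_int v = real_of_int (n * int M)" using M by (simp add: field_simps)
    then have v: "v = n * int M" by (simp only: of_int_eq_iff)
    then have "n \<noteq> 0" using False by auto
    then have "int M \<le> \<bar>n\<bar> * int M" using mult_right_mono[of 1 "\<bar>n\<bar>" "int M"] by simp
    then show False using assms v by (simp add: abs_mult)
  qed
  moreover have "z ^ M = 1"
    unfolding pw using M cis_multiple_2pi[of "real_of_int v"] by (simp add: mult.assoc)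
  ultimately have "(\<Sum>t<M. z ^ t) = 0" by (simp add: geometric_sum)
  then show ?thesis using False by (simp add: pw)
qed simp

text \<open>The group is {1, -1} times a free abelian group on the primes.
  \<open>fst \<omega>\<close> picks an M-th root of unity for each prime of P, and
  \<open>snd \<omega>\<close> decides whether the sign enters.\<close>

definition rat_character :: "nat set \<Rightarrow> nat \<Rightarrow> (nat \<Rightarrow> nat) \<times> bool \<Rightarrow> rat \<Rightarrow> complex" where
  "rat_character P M \<omega> y = (if snd \<omega> \<and> y < 0 then -1 else 1) *
     (\<Prod>p\<in>P. cis (2 * pi * real (fst \<omega> p) * real_of_int (padic_val p y) / real M))"

lemma rat_character_mult:
  assumes "\<forall>p\<in>P. prime p" "x \<noteq> 0" "y \<noteq> 0"
  shows "rat_character P M \<omega> (x * y) = rat_character P M \<omega> x * rat_character P M \<omega> y"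
proof -
  have "(\<Prod>p\<in>P. cis (2 * pi * real (fst \<omega> p) * real_of_int (padic_val p (x * y)) / real M)) =
    (\<Prod>p\<in>P. cis (2 * pi * real (fst \<omega> p) * real_of_int (padic_val p x) / real M) *
      cis (2 * pi * real (fst \<omega> p) * real_of_int (padic_val p y) / real M))"
    by (intro prod.cong refl)
      (use assms in \<open>simp add: padic_val_mult cis_mult add_divide_distrib distrib_left\<close>)
  then show ?thesis
    using assms(2,3) by (auto simp: rat_character_def prod.distrib mult_less_0_iff)
qed

lemma rat_character_cnj: "rat_character P M \<omega> x * cnj (rat_character P M \<omega> x) = 1"
proof -
  have "norm (rat_character P M \<omega> x) = 1"
    by (simp add: rat_character_def norm_mult flip: prod_norm)
  then show ?thesis by (simp add: complex_norm_square[symmetric])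
qed

lemma sum_rat_character:
  assumes "finite P"
  shows "(\<Sum>\<omega>\<in>(P \<rightarrow>\<^sub>E {..<M}) \<times> UNIV. rat_character P M \<omega> y) =
    (if y < 0 then 0 else 2) *
    (\<Prod>p\<in>P. \<Sum>t<M. cis (2 * pi * real t * real_of_int (padic_val p y) / real M))"
proof -
  have "(\<Sum>\<omega>\<in>(P \<rightarrow>\<^sub>E {..<M}) \<times> UNIV. rat_character P M \<omega> y) =
    (\<Sum>\<tau>\<in>P \<rightarrow>\<^sub>E {..<M}. \<Sum>e\<in>(UNIV :: bool set). rat_character P M (\<tau>, e) y)"
    by (simp add: sum.cartesian_product)
  also have "\<dots> = (\<Sum>\<tau>\<in>P \<rightarrow>\<^sub>E {..<M}. (if y < 0 then 0 else 2) *
      (\<Prod>p\<in>P. cis (2 * pi * real (\<tau> p) * real_of_int (padic_val p y) / real M)))"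
    by (simp add: UNIV_bool rat_character_def)
  also have "\<dots> = (if y < 0 then 0 else 2) *
    (\<Prod>p\<in>P. \<Sum>t<M. cis (2 * pi * real t * real_of_int (padic_val p y) / real M))"
    by (subst prod_sum_PiE) (use assms in \<open>auto simp: sum_distrib_left\<close>)
  finally show ?thesis .
qed

text \<open>On a finite set the dual group may be replaced by finitely many characters: P holds all
  primes occurring in Y, and M exceeds all exponents, so that no nonzero exponent vanishes modulo
  M.\<close>

lemma separating_rat_characters:
  fixes Y :: "rat set"
  assumes "finite Y" "0 \<notin> Y"
  obtains \<Omega> :: "((nat \<Rightarrow> nat) \<times> bool) set" and \<xi> :: "(nat \<Rightarrow> nat) \<times> bool \<Rightarrow> rat \<Rightarrow> complex"
  where "finite \<Omega>" "\<Omega> \<noteq> {}"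
    "\<And>\<omega> x y. x \<noteq> 0 \<Longrightarrow> y \<noteq> 0 \<Longrightarrow> \<xi> \<omega> (x * y) = \<xi> \<omega> x * \<xi> \<omega> y"
    "\<And>\<omega> x. \<xi> \<omega> x * cnj (\<xi> \<omega> x) = 1"
    "\<And>y. y \<in> Y \<Longrightarrow> (\<Sum>\<omega>\<in>\<Omega>. \<xi> \<omega> y) = (if y = 1 then of_nat (card \<Omega>) else 0)"
proof -
  define P where "P = (\<Union>y\<in>Y. {p. prime p \<and> padic_val p y \<noteq> 0})"
  have "finite P" unfolding P_def
  proof (rule finite_UN_I[OF assms(1)])
    fix y assume "y \<in> Y"
    then have "y \<noteq> 0" using assms(2) by metis
    then show "finite {p. prime p \<and> padic_val p y \<noteq> 0}" by (rule finite_padic_support)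
  qed
  moreover have "\<forall>p\<in>P. prime p" by (auto simp: P_def)
  ultimately have P: "finite P" "\<forall>p\<in>P. prime p" .
  define M where "M = Suc (\<Sum>y\<in>Y. \<Sum>p\<in>P. nat \<bar>padic_val p y\<bar>)"
  have M: "\<bar>padic_val p y\<bar> < int M" if "p \<in> P" "y \<in> Y" for p y
  proof -
    have "nat \<bar>padic_val p y\<bar> \<le> (\<Sum>p\<in>P. nat \<bar>padic_val p y\<bar>)"
      using that P by (intro member_le_sum) auto
    also have "\<dots> \<le> (\<Sum>y\<in>Y. \<Sum>p\<in>P. nat \<bar>padic_val p y\<bar>)"
      using that assms by (intro member_le_sum[where f = "\<lambda>y. \<Sum>p\<in>P. nat \<bar>padic_val p y\<bar>"]) auto
    finally show ?thesis unfolding M_def by linarith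
  qed
  define \<Omega> :: "((nat \<Rightarrow> nat) \<times> bool) set" where "\<Omega> = (P \<rightarrow>\<^sub>E {..<M}) \<times> UNIV"
  have "card \<Omega> = 2 * M ^ card P"
    unfolding \<Omega>_def using P by (simp add: card_cartesian_product card_PiE)
  then have card: "(of_nat (card \<Omega>) :: complex) = 2 * of_nat M ^ card P" by simp
  have s: "(\<Sum>\<omega>\<in>\<Omega>. rat_character P M \<omega> y) = (if y = 1 then of_nat (card \<Omega>) else 0)" if "y \<in> Y" for y
  proof -
    have "(\<Prod>p\<in>P. \<Sum>t<M. cis (2 * pi * real t * real_of_int (padic_val p y) / real M))
      = (\<Prod>p\<in>P. if padic_val p y = 0 then of_nat M else 0)"
      by (intro prod.cong refl sum_cis_multiples M that)
    then have e: "(\<Sum>\<omega>\<in>\<Omega>. rat_character P M \<omega> y) = (if y < 0 then 0 else 2) *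
      (\<Prod>p\<in>P. if padic_val p y = 0 then of_nat M else 0)"
      unfolding \<Omega>_def using sum_rat_character[OF P(1)] by simp
    show ?thesis
    proof (cases "\<bar>y\<bar> = 1")
      case True
      then have y: "y = 1 \<or> y = -1" by (auto simp: abs_if split: if_splits)
      then have "(\<Prod>p\<in>P. if padic_val p y = 0 then of_nat M else 0) = (of_nat M :: complex) ^ card P"
        using P padic_val_1 padic_val_minus_1 by (subst prod_constant[symmetric], intro prod.cong) auto
      then show ?thesis unfolding e using y card by auto
    next
      case False
      have "y \<noteq> 0" using assms(2) that by metis
      then obtain p where p: "prime p" "padic_val p y \<noteq> 0"
        using exists_padic_val_nonzero[OF _ False] by blast
      then have "p \<in> P" using that by (auto simp: P_def)
      then have "(\<Prod>p\<in>P. if padic_val p y = 0 then of_nat M else 0) = (0 :: complex)"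
        using P(1) p(2) by (intro prod_zero) auto
      then show ?thesis unfolding e using False by auto
    qed
  qed
  show ?thesis
  proof (rule that[of \<Omega> "rat_character P M"])
    show "finite \<Omega>" unfolding \<Omega>_def using P by (simp add: finite_PiE)
    show "\<Omega> \<noteq> {}" using \<open>card \<Omega> = 2 * M ^ card P\<close> by (auto simp: M_def)
  qed (use P s in \<open>auto simp: rat_character_mult rat_character_cnj\<close>)
qed

text \<open>After division of each factor by its norm, the inequality of arithmetic and geometric
  means bounds the product pointwise by a mean of n-th powers, each of which sums to 1. A factor of
  norm 0 makes the left side vanish.\<close>

lemma holder_sum_prod:
  fixes G :: "'i \<Rightarrow> 'w \<Rightarrow> real"
  assumes "finite I" "I \<noteq> {}" "finite \<Omega>" "\<And>i \<omega>. i \<in> I \<Longrightarrow> \<omega> \<in> \<Omega> \<Longrightarrow> G i \<omega> \<ge> 0"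
  shows "(\<Sum>\<omega>\<in>\<Omega>. \<Prod>i\<in>I. G i \<omega>) \<le> (\<Prod>i\<in>I. root (card I) (\<Sum>\<omega>\<in>\<Omega>. G i \<omega> ^ card I))"
proof -
  define n where "n = card I"
  have n: "n > 0" using assms by (simp add: n_def card_gt_0_iff)
  define c where "c i = root n (\<Sum>\<omega>\<in>\<Omega>. G i \<omega> ^ n)" for i
  have c0: "c i \<ge> 0" if "i \<in> I" for i
    unfolding c_def using assms that by (intro real_root_ge_zero sum_nonneg) auto
  have cn: "c i ^ n = (\<Sum>\<omega>\<in>\<Omega>. G i \<omega> ^ n)" if "i \<in> I" for i
    unfolding c_def using assms that n by (intro real_root_pow_pos2 sum_nonneg) auto
  show ?thesis
  proof (cases "\<exists>i\<in>I. c i = 0")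
    case True
    then obtain i where i: "i \<in> I" "c i = 0" by blast
    then have "(\<Sum>\<omega>\<in>\<Omega>. G i \<omega> ^ n) = 0" using cn n by (metis power_eq_0_iff)
    then have z: "G i \<omega> = 0" if "\<omega> \<in> \<Omega>" for \<omega>
      using that assms(3) sum_nonneg_eq_0_iff[of \<Omega> "\<lambda>\<omega>. G i \<omega> ^ n"] assms(4) i n by auto
    have "(\<Sum>\<omega>\<in>\<Omega>. \<Prod>i\<in>I. G i \<omega>) = 0"
      by (intro sum.neutral ballI prod_zero assms(1) bexI[of _ i] z i)
    also have "0 \<le> (\<Prod>i\<in>I. c i)" using c0 by (intro prod_nonneg) auto
    finally show ?thesis by (simp add: c_def n_def)
  next
    case False
    then have cpos: "c i > 0" if "i \<in> I" for i using c0[OF that] that by force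
    have amgm: "(\<Prod>i\<in>I. G i \<omega> / c i) \<le> (\<Sum>i\<in>I. (G i \<omega> / c i) ^ n / n)" if w: "\<omega> \<in> \<Omega>" for \<omega>
    proof -
      have nn: "G i \<omega> / c i \<ge> 0" if "i \<in> I" for i using assms(4) w that c0 by simp
      have "(\<Prod>i\<in>I. (G i \<omega> / c i) ^ n) powr (1 / card I) \<le> (\<Sum>i\<in>I. (G i \<omega> / c i) ^ n / card I)"
        using nn by (intro arith_geom_mean assms) auto
      moreover have "(\<Prod>i\<in>I. (G i \<omega> / c i) ^ n) powr (1 / card I) = (\<Prod>i\<in>I. G i \<omega> / c i)"
      proof -
        have "(\<Prod>i\<in>I. G i \<omega> / c i) \<ge> 0" using nn by (intro prod_nonneg) auto
        then show ?thesis using n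
          by (cases "(\<Prod>i\<in>I. G i \<omega> / c i) = 0")
            (simp_all add: n_def[symmetric] real_root_power_cancel flip: prod_power_distrib root_powr_inverse)
      qed
      ultimately show ?thesis by (simp add: n_def)
    qed
    have "(\<Sum>\<omega>\<in>\<Omega>. \<Prod>i\<in>I. G i \<omega> / c i) \<le> (\<Sum>\<omega>\<in>\<Omega>. \<Sum>i\<in>I. (G i \<omega> / c i) ^ n / n)"
      by (intro sum_mono amgm)
    also have "\<dots> = (\<Sum>i\<in>I. (\<Sum>\<omega>\<in>\<Omega>. G i \<omega> ^ n) / c i ^ n / n)"
      by (subst sum.swap) (simp add: power_divide sum_divide_distrib)
    also have "\<dots> = (\<Sum>i\<in>I. 1 / n)"
      by (intro sum.cong refl) (use cn cpos in \<open>force simp: divide_simps\<close>)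
    also have "\<dots> = 1" using n by (simp add: n_def)
    finally have "(\<Sum>\<omega>\<in>\<Omega>. \<Prod>i\<in>I. G i \<omega>) / (\<Prod>i\<in>I. c i) \<le> 1"
      by (simp add: prod_dividef sum_divide_distrib)
    moreover have "(\<Prod>i\<in>I. c i) > 0" using cpos by (intro prod_pos) auto
    ultimately show ?thesis by (simp add: c_def n_def divide_simps split: if_splits)
  qed
qed

section \<open>Energies with a separate index set at each position, and their Fourier form\<close>

definition product_solutions :: "nat \<Rightarrow> ('b \<Rightarrow> rat) \<Rightarrow> (nat \<Rightarrow> 'b set) \<Rightarrow> (nat \<Rightarrow> 'b) set" where
  "product_solutions k \<phi> X =
     {b \<in> Pi\<^sub>E {..<2 * k} X. (\<Prod>i<k. \<phi> (b i)) = (\<Prod>i=k..<2 * k. \<phi> (b i))}"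

definition mixed_energy :: "nat \<Rightarrow> ('b \<Rightarrow> rat) \<Rightarrow> ('b \<Rightarrow> real) \<Rightarrow> (nat \<Rightarrow> 'b set) \<Rightarrow> real" where
  "mixed_energy k \<phi> w X = (\<Sum>b\<in>product_solutions k \<phi> X. \<Prod>i<2 * k. w (b i))"

text \<open>The L^(2k)-norm of the Fourier sum of w over X. The indices, which carry the weights,
  are kept apart from the values \<phi>, so that 1 + a can be replaced by 1 + 1/a while the weights
  stay.\<close>

definition energy_norm :: "nat \<Rightarrow> ('b \<Rightarrow> rat) \<Rightarrow> ('b \<Rightarrow> real) \<Rightarrow> 'b set \<Rightarrow> real" where
  "energy_norm k \<phi> w X = root (2 * k) (mixed_energy k \<phi> w (\<lambda>_. X))"

lemma finite_product_solutions:
  "(\<And>i. i < 2 * k \<Longrightarrow> finite (X i)) \<Longrightarrow> finite (product_solutions k \<phi> X)"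
  unfolding product_solutions_def by (rule finite_subset[of _ "Pi\<^sub>E {..<2 * k} X"]) (auto intro: finite_PiE)

lemma lessThan_double_split: "{..<2 * k} = {..<k} \<union> {k..<2 * k}" for k :: nat
  by auto

lemma prod_lessThan_double:
  "(\<Prod>i<2 * k. f i) = (\<Prod>i<k. f i) * (\<Prod>i=k..<2 * k. f i)" for f :: "nat \<Rightarrow> 'a::comm_monoid_mult"
  unfolding lessThan_double_split by (rule prod.union_disjoint) auto

definition fourier_sum :: "('b \<Rightarrow> complex) \<Rightarrow> ('b \<Rightarrow> real) \<Rightarrow> 'b set \<Rightarrow> complex" where
  "fourier_sum \<psi> w X = (\<Sum>a\<in>X. of_real (w a) * \<psi> a)"

text \<open>Expanding the product of sums gives one term for each tuple. Conjugation in the second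
  half turns \<xi> into its inverse, so the term carries \<xi> at the quotient of the two half
  products, and summing over \<open>\<Omega>\<close> detects whether it is 1.\<close>

lemma mixed_energy_fourier:
  fixes \<xi> :: "'w \<Rightarrow> rat \<Rightarrow> complex"
  assumes fin: "\<And>i. i < 2 * k \<Longrightarrow> finite (X i)"
    and nz: "\<And>i a. i < 2 * k \<Longrightarrow> a \<in> X i \<Longrightarrow> \<phi> a \<noteq> 0"
    and chi: "\<And>\<omega> x y. x \<noteq> 0 \<Longrightarrow> y \<noteq> 0 \<Longrightarrow> \<xi> \<omega> (x * y) = \<xi> \<omega> x * \<xi> \<omega> y"
      "\<And>\<omega> x. \<xi> \<omega> x * cnj (\<xi> \<omega> x) = 1"
    and sep: "\<And>b. b \<in> Pi\<^sub>E {..<2 * k} X \<Longrightarrow>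
      (\<Sum>\<omega>\<in>\<Omega>. \<xi> \<omega> ((\<Prod>i<k. \<phi> (b i)) / (\<Prod>i=k..<2 * k. \<phi> (b i)))) =
      (if (\<Prod>i<k. \<phi> (b i)) / (\<Prod>i=k..<2 * k. \<phi> (b i)) = 1 then of_nat (card \<Omega>) else 0)"
  shows "of_real (real (card \<Omega>) * mixed_energy k \<phi> w X) =
    (\<Sum>\<omega>\<in>\<Omega>. (\<Prod>i<k. fourier_sum (\<lambda>a. \<xi> \<omega> (\<phi> a)) w (X i)) *
      (\<Prod>i=k..<2 * k. cnj (fourier_sum (\<lambda>a. \<xi> \<omega> (\<phi> a)) w (X i))))"
proof -
  have one: "\<xi> \<omega> 1 = 1" for \<omega> using chi(1)[of 1 1 \<omega>] chi(2)[of \<omega> 1] by auto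
  have chi_prod: "\<xi> \<omega> (\<Prod>i\<in>I. f i) = (\<Prod>i\<in>I. \<xi> \<omega> (f i))" if "\<And>i. i \<in> I \<Longrightarrow> f i \<noteq> 0" for \<omega> I and f :: "nat \<Rightarrow> rat"
    using that by (induction I rule: infinite_finite_induct) (auto simp: one chi(1))
  have chi_inv: "\<xi> \<omega> (inverse x) = cnj (\<xi> \<omega> x)" if "x \<noteq> 0" for \<omega> x
  proof -
    have "\<xi> \<omega> x * \<xi> \<omega> (inverse x) = 1" using chi(1)[of x "inverse x" \<omega>] that one by simp
    then show ?thesis using chi(2)[of \<omega> x] by (metis mult_cancel_left mult_zero_left zero_neq_one)
  qed
  define h where "h \<omega> i a = of_real (w a) * (if i < k then \<xi> \<omega> (\<phi> a) else cnj (\<xi> \<omega> (\<phi> a)))" for \<omega> i a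
  have split: "(\<Prod>i<2 * k. h \<omega> i (b i)) = of_real (\<Prod>i<2 * k. w (b i)) *
      \<xi> \<omega> ((\<Prod>i<k. \<phi> (b i)) / (\<Prod>i=k..<2 * k. \<phi> (b i)))" if b: "b \<in> Pi\<^sub>E {..<2 * k} X" for \<omega> b
  proof -
    have nz': "\<phi> (b i) \<noteq> 0" if "i < 2 * k" for i using nz[OF that] b that by auto
    have "\<xi> \<omega> ((\<Prod>i<k. \<phi> (b i)) / (\<Prod>i=k..<2 * k. \<phi> (b i))) =
      \<xi> \<omega> (\<Prod>i<k. \<phi> (b i)) * cnj (\<xi> \<omega> (\<Prod>i=k..<2 * k. \<phi> (b i)))"
      unfolding divide_inverse using nz' by (subst chi(1)) (auto simp: chi_inv)
    also have "\<dots> = (\<Prod>i<k. \<xi> \<omega> (\<phi> (b i))) * (\<Prod>i=k..<2 * k. cnj (\<xi> \<omega> (\<phi> (b i))))"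
    proof -
      have "\<xi> \<omega> (\<Prod>i<k. \<phi> (b i)) = (\<Prod>i<k. \<xi> \<omega> (\<phi> (b i)))"
        "\<xi> \<omega> (\<Prod>i=k..<2 * k. \<phi> (b i)) = (\<Prod>i=k..<2 * k. \<xi> \<omega> (\<phi> (b i)))"
        by (rule chi_prod, rule nz', simp)+
      then show ?thesis by simp
    qed
    finally show ?thesis by (simp add: prod_lessThan_double h_def prod.distrib)
  qed
  have "(\<Sum>\<omega>\<in>\<Omega>. (\<Prod>i<k. fourier_sum (\<lambda>a. \<xi> \<omega> (\<phi> a)) w (X i)) *
      (\<Prod>i=k..<2 * k. cnj (fourier_sum (\<lambda>a. \<xi> \<omega> (\<phi> a)) w (X i)))) =
    (\<Sum>\<omega>\<in>\<Omega>. \<Prod>i<2 * k. \<Sum>a\<in>X i. h \<omega> i a)"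
    by (simp add: prod_lessThan_double h_def fourier_sum_def)
  also have "\<dots> = (\<Sum>\<omega>\<in>\<Omega>. \<Sum>b\<in>Pi\<^sub>E {..<2 * k} X. \<Prod>i<2 * k. h \<omega> i (b i))"
    by (intro sum.cong refl prod_sum_PiE) (use fin in auto)
  also have "\<dots> = (\<Sum>b\<in>Pi\<^sub>E {..<2 * k} X. of_real (\<Prod>i<2 * k. w (b i)) *
      (\<Sum>\<omega>\<in>\<Omega>. \<xi> \<omega> ((\<Prod>i<k. \<phi> (b i)) / (\<Prod>i=k..<2 * k. \<phi> (b i)))))"
    by (subst sum.swap) (intro sum.cong refl, simp only: split sum_distrib_left)
  also have "\<dots> = (\<Sum>b\<in>Pi\<^sub>E {..<2 * k} X.
      if (\<Prod>i<k. \<phi> (b i)) = (\<Prod>i=k..<2 * k. \<phi> (b i)) then of_nat (card \<Omega>) * of_real (\<Prod>i<2 * k. w (b i)) else 0)"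
  proof (intro sum.cong refl)
    fix b assume b: "b \<in> Pi\<^sub>E {..<2 * k} X"
    then have "(\<Prod>i=k..<2 * k. \<phi> (b i)) \<noteq> 0" using nz by (auto simp: PiE_iff)
    then show "of_real (\<Prod>i<2 * k. w (b i)) *
      (\<Sum>\<omega>\<in>\<Omega>. \<xi> \<omega> ((\<Prod>i<k. \<phi> (b i)) / (\<Prod>i=k..<2 * k. \<phi> (b i)))) =
      (if (\<Prod>i<k. \<phi> (b i)) = (\<Prod>i=k..<2 * k. \<phi> (b i)) then of_nat (card \<Omega>) * of_real (\<Prod>i<2 * k. w (b i)) else 0)"
      using sep[OF b] by simp
  qed
  also have "\<dots> = (\<Sum>b\<in>product_solutions k \<phi> X. of_nat (card \<Omega>) * of_real (\<Prod>i<2 * k. w (b i)))"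
    unfolding product_solutions_def
    by (rule sum.inter_filter[symmetric]) (use fin in \<open>auto intro: finite_PiE\<close>)
  also have "\<dots> = of_real (real (card \<Omega>) * mixed_energy k \<phi> w X)"
    by (simp add: mixed_energy_def sum_distrib_left)
  finally show ?thesis by simp
qed

text \<open>The mixed energy is at most the average of a product of 2k moduli of Fourier sums. When
  all index sets agree this is an equality, because each sum and its conjugate occur k times;
  Hoelder's inequality links the two cases.\<close>

lemma mixed_energy_le_prod_energy_norm:
  assumes k: "k \<ge> 1" and fin: "\<And>i. i < 2 * k \<Longrightarrow> finite (X i)"
    and nz: "\<And>i a. i < 2 * k \<Longrightarrow> a \<in> X i \<Longrightarrow> \<phi> a \<noteq> 0"
  shows "mixed_energy k \<phi> w X \<le> (\<Prod>i<2 * k. energy_norm k \<phi> w (X i))"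
proof -
  define Z where "Z = (\<Union>i<2 * k. X i)"
  have Z: "finite Z" "\<And>i. i < 2 * k \<Longrightarrow> X i \<subseteq> Z" "\<And>a. a \<in> Z \<Longrightarrow> \<phi> a \<noteq> 0"
    using fin nz by (auto simp: Z_def)
  \<comment> \<open>The quotients of all tuples over the union Z are taken, so that one and the same
    \<open>\<Omega>\<close> serves the mixed energy and all the pure ones.\<close>
  define Y where "Y = (\<lambda>b. (\<Prod>i<k. \<phi> (b i)) / (\<Prod>i=k..<2 * k. \<phi> (b i))) ` ({..<2 * k} \<rightarrow>\<^sub>E Z)"
  have "finite Y" unfolding Y_def using Z by (intro finite_imageI finite_PiE) auto
  moreover have "0 \<notin> Y" unfolding Y_def using Z(3) by (auto simp: PiE_iff)
  ultimately obtain \<Omega> :: "((nat \<Rightarrow> nat) \<times> bool) set" and \<xi> where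
    \<Omega>: "finite \<Omega>" "\<Omega> \<noteq> {}" and
    chi: "\<And>\<omega> x y. x \<noteq> 0 \<Longrightarrow> y \<noteq> 0 \<Longrightarrow> \<xi> \<omega> (x * y) = \<xi> \<omega> x * \<xi> \<omega> y"
    "\<And>\<omega> x. \<xi> \<omega> x * cnj (\<xi> \<omega> x) = 1" and
    sep: "\<And>y. y \<in> Y \<Longrightarrow> (\<Sum>\<omega>\<in>\<Omega>. \<xi> \<omega> y) = (if y = 1 then of_nat (card \<Omega>) else 0)"
    by (rule separating_rat_characters) blast
  define N where "N = real (card \<Omega>)"
  have N: "N > 0" using \<Omega> by (simp add: N_def card_gt_0_iff)
  define F where "F \<omega> S = norm (fourier_sum (\<lambda>a. \<xi> \<omega> (\<phi> a)) w S)" for \<omega> S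
  have four: "of_real (N * mixed_energy k \<phi> w V) =
    (\<Sum>\<omega>\<in>\<Omega>. (\<Prod>i<k. fourier_sum (\<lambda>a. \<xi> \<omega> (\<phi> a)) w (V i)) *
      (\<Prod>i=k..<2 * k. cnj (fourier_sum (\<lambda>a. \<xi> \<omega> (\<phi> a)) w (V i))))"
    if V: "\<And>i. i < 2 * k \<Longrightarrow> V i \<subseteq> Z" for V
    unfolding N_def
  proof (rule mixed_energy_fourier[where \<xi> = \<xi> and \<Omega> = \<Omega> and X = V and \<phi> = \<phi> and k = k])
    show "finite (V i)" if "i < 2 * k" for i using V[OF that] Z(1) by (rule finite_subset)
    show "\<phi> a \<noteq> 0" if "i < 2 * k" "a \<in> V i" for i a using V[OF that(1)] that(2) Z(3) by blast
    fix b assume "b \<in> Pi\<^sub>E {..<2 * k} V"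
    moreover have "Pi\<^sub>E {..<2 * k} V \<subseteq> {..<2 * k} \<rightarrow>\<^sub>E Z" by (intro PiE_mono V) simp
    ultimately have "b \<in> {..<2 * k} \<rightarrow>\<^sub>E Z" by blast
    then show "(\<Sum>\<omega>\<in>\<Omega>. \<xi> \<omega> ((\<Prod>i<k. \<phi> (b i)) / (\<Prod>i=k..<2 * k. \<phi> (b i)))) =
      (if (\<Prod>i<k. \<phi> (b i)) / (\<Prod>i=k..<2 * k. \<phi> (b i)) = 1 then of_nat (card \<Omega>) else 0)"
      by (intro sep) (auto simp: Y_def)
  qed (fact chi)+
  have le: "N * mixed_energy k \<phi> w X \<le> (\<Sum>\<omega>\<in>\<Omega>. \<Prod>i<2 * k. F \<omega> (X i))"
  proof -
    have "N * mixed_energy k \<phi> w X \<le> norm (of_real (N * mixed_energy k \<phi> w X) :: complex)"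
      unfolding norm_of_real by (rule abs_ge_self)
    also have "\<dots> \<le> (\<Sum>\<omega>\<in>\<Omega>. \<Prod>i<2 * k. F \<omega> (X i))"
      by (subst four[of X], erule Z(2), rule sum_norm_le)
        (simp add: norm_mult prod_lessThan_double F_def flip: prod_norm)
    finally show ?thesis .
  qed
  have en: "N * mixed_energy k \<phi> w (\<lambda>_. S) = (\<Sum>\<omega>\<in>\<Omega>. F \<omega> S ^ (2 * k))" if "S \<subseteq> Z" for S
  proof -
    have "(of_real (N * mixed_energy k \<phi> w (\<lambda>_. S)) :: complex) = of_real (\<Sum>\<omega>\<in>\<Omega>. F \<omega> S ^ (2 * k))"
    proof -
      have "(\<Prod>i<k. z) * (\<Prod>i=k..<2 * k. cnj z) = of_real (norm z ^ (2 * k))" for z :: complex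
        by (simp add: power_mult flip: power_mult_distrib complex_norm_square)
      then show ?thesis using four[of "\<lambda>_. S"] that by (simp only: F_def of_real_sum)
    qed
    then show ?thesis by (simp only: of_real_eq_iff)
  qed
  have "N * mixed_energy k \<phi> w X \<le> (\<Sum>\<omega>\<in>\<Omega>. \<Prod>i<2 * k. F \<omega> (X i))" by (rule le)
  also have "\<dots> \<le> (\<Prod>i<2 * k. root (2 * k) (\<Sum>\<omega>\<in>\<Omega>. F \<omega> (X i) ^ (2 * k)))"
    using holder_sum_prod[of "{..<2 * k}" \<Omega> "\<lambda>i \<omega>. F \<omega> (X i)"] k \<Omega> by (auto simp: F_def lessThan_empty_iff)
  also have "\<dots> = (\<Prod>i<2 * k. root (2 * k) N * energy_norm k \<phi> w (X i))"
    by (intro prod.cong refl) (simp add: energy_norm_def real_root_mult flip: en[OF Z(2)])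
  also have "\<dots> = N * (\<Prod>i<2 * k. energy_norm k \<phi> w (X i))"
    using k N by (simp add: prod.distrib real_root_pow_pos2)
  finally show ?thesis using N by simp
qed

subsection \<open>Decomposition of energies\<close>

lemma mixed_energy_nonneg:
  assumes "\<And>i a. i < 2 * k \<Longrightarrow> a \<in> X i \<Longrightarrow> w a \<ge> 0"
  shows "mixed_energy k \<phi> w X \<ge> 0"
  unfolding mixed_energy_def product_solutions_def
  by (intro sum_nonneg prod_nonneg) (use assms in \<open>auto simp: PiE_iff\<close>)

lemma energy_norm_nonneg:
  assumes "\<And>a. a \<in> X \<Longrightarrow> w a \<ge> 0"
  shows "energy_norm k \<phi> w X \<ge> 0"
  unfolding energy_norm_def
  by (intro real_root_ge_zero mixed_energy_nonneg) (use assms in auto)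

lemma energy_norm_power:
  assumes "k \<ge> 1" "\<And>a. a \<in> X \<Longrightarrow> w a \<ge> 0"
  shows "energy_norm k \<phi> w X ^ (2 * k) = mixed_energy k \<phi> w (\<lambda>_. X)"
  unfolding energy_norm_def
  by (intro real_root_pow_pos2 mixed_energy_nonneg) (use assms in auto)

lemma energy_norm_mono:
  assumes "k \<ge> 1" "finite X" "\<And>a. a \<in> X \<Longrightarrow> w a \<ge> 0"
    and "product_solutions k \<phi> (\<lambda>_. X) \<subseteq> product_solutions k \<psi> (\<lambda>_. X)"
  shows "energy_norm k \<phi> w X \<le> energy_norm k \<psi> w X"
proof -
  have "mixed_energy k \<phi> w (\<lambda>_. X) \<le> mixed_energy k \<psi> w (\<lambda>_. X)"
    unfolding mixed_energy_def
  proof (rule sum_mono2)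
    show "finite (product_solutions k \<psi> (\<lambda>_. X))" using assms(2) by (intro finite_product_solutions)
    show "0 \<le> (\<Prod>i<2 * k. w (b i))"
      if "b \<in> product_solutions k \<psi> (\<lambda>_. X) - product_solutions k \<phi> (\<lambda>_. X)" for b
      using that assms(3) by (intro prod_nonneg) (auto simp: product_solutions_def PiE_iff)
  qed fact
  then show ?thesis unfolding energy_norm_def using assms(1) by (intro real_root_le_mono) auto
qed

lemma sum_le_sum_cover:
  fixes g :: "'a \<Rightarrow> real"
  assumes "finite I" "\<And>i. i \<in> I \<Longrightarrow> finite (A i)" "S \<subseteq> (\<Union>i\<in>I. A i)"
    and "\<And>i x. i \<in> I \<Longrightarrow> x \<in> A i \<Longrightarrow> g x \<ge> 0"
  shows "sum g S \<le> (\<Sum>i\<in>I. sum g (A i))"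
proof -
  have "sum g S \<le> sum g (\<Union>i\<in>I. A i)"
    by (rule sum_mono2) (use assms in auto)
  also have "(\<Union>i\<in>I. A i) = snd ` Sigma I A" by force
  also have "sum g (snd ` Sigma I A) \<le> sum (g \<circ> snd) (Sigma I A)"
    by (rule sum_image_le) (use assms in auto)
  also have "\<dots> = (\<Sum>i\<in>I. sum g (A i))"
    using assms(1,2) by (subst sum.Sigma) (auto simp: case_prod_unfold)
  finally show ?thesis .
qed

text \<open>The triangle inequality of L^(2k): solutions are sorted by the classes of their entries,
  each type is bounded by a product of norms, and the sum of these products is the 2k-th power of
  the right side.\<close>

lemma energy_norm_le_sum_classes:
  assumes k: "k \<ge> 1" and fin: "finite X" and w: "\<And>a. a \<in> X \<Longrightarrow> w a \<ge> 0"
    and nz: "\<And>a. a \<in> X \<Longrightarrow> \<phi> a \<noteq> 0"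
  shows "energy_norm k \<phi> w X \<le> (\<Sum>j\<in>\<kappa> ` X. energy_norm k \<phi> w {x \<in> X. \<kappa> x = j})"
proof -
  define C where "C j = {x \<in> X. \<kappa> x = j}" for j
  have C: "finite (C j)" "C j \<subseteq> X" for j using fin by (auto simp: C_def)
  define I where "I = {..<2 * k} \<rightarrow>\<^sub>E \<kappa> ` X"
  have finI: "finite I" unfolding I_def using fin by (intro finite_PiE) auto
  have "mixed_energy k \<phi> w (\<lambda>_. X) \<le> (\<Sum>c\<in>I. mixed_energy k \<phi> w (\<lambda>i. C (c i)))"
    unfolding mixed_energy_def
  proof (rule sum_le_sum_cover[OF finI])
    show "product_solutions k \<phi> (\<lambda>_. X) \<subseteq> (\<Union>c\<in>I. product_solutions k \<phi> (\<lambda>i. C (c i)))"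
    proof
      fix b assume b: "b \<in> product_solutions k \<phi> (\<lambda>_. X)"
      define c where "c = restrict (\<lambda>i. \<kappa> (b i)) {..<2 * k}"
      have "c \<in> I" using b by (auto simp: c_def I_def product_solutions_def)
      moreover have "b \<in> product_solutions k \<phi> (\<lambda>i. C (c i))"
        using b by (auto simp: c_def C_def product_solutions_def PiE_iff)
      ultimately show "b \<in> (\<Union>c\<in>I. product_solutions k \<phi> (\<lambda>i. C (c i)))" by blast
    qed
    show "finite (product_solutions k \<phi> (\<lambda>i. C (c i)))" for c
      by (intro finite_product_solutions C)
    show "0 \<le> (\<Prod>i<2 * k. w (b i))" if "b \<in> product_solutions k \<phi> (\<lambda>i. C (c i))" for b c
      using that C(2) w by (intro prod_nonneg) (auto simp: product_solutions_def PiE_iff C_def)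
  qed
  also have "\<dots> \<le> (\<Sum>c\<in>I. \<Prod>i<2 * k. energy_norm k \<phi> w (C (c i)))"
    by (intro sum_mono mixed_energy_le_prod_energy_norm k C) (use nz C(2) in blast)
  also have "\<dots> = (\<Prod>i<2 * k. \<Sum>j\<in>\<kappa> ` X. energy_norm k \<phi> w (C j))"
    unfolding I_def by (rule prod_sum_PiE[symmetric]) (use fin in auto)
  also have "\<dots> = (\<Sum>j\<in>\<kappa> ` X. energy_norm k \<phi> w (C j)) ^ (2 * k)" by simp
  finally have "energy_norm k \<phi> w X ^ (2 * k) \<le> (\<Sum>j\<in>\<kappa> ` X. energy_norm k \<phi> w (C j)) ^ (2 * k)"
    using energy_norm_power[of k X w \<phi>] k w by simp
  moreover have "0 \<le> (\<Sum>j\<in>\<kappa> ` X. energy_norm k \<phi> w (C j))"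
    by (intro sum_nonneg energy_norm_nonneg) (use w C(2) in blast)
  ultimately show ?thesis unfolding C_def using k by (subst (asm) power_mono_iff) (auto intro: energy_norm_nonneg w)
qed

lemma sum_over_classes:
  fixes g :: "'a \<Rightarrow> real"
  assumes "finite X"
  shows "(\<Sum>j\<in>\<kappa> ` X. \<Sum>a\<in>{x \<in> X. \<kappa> x = j}. g a) = sum g X"
  using sum.image_gen[OF assms, of g \<kappa>] by simp

text \<open>Triangle inequality and Cauchy-Schwarz. The loss is the number of classes, which is
  acceptable for sign patterns and for the singletons of a small set.\<close>

lemma energy_norm_bound_classes:
  assumes k: "k \<ge> 1" and fin: "finite X" and w: "\<And>a. a \<in> X \<Longrightarrow> w a \<ge> 0"
    and nz: "\<And>a. a \<in> X \<Longrightarrow> \<phi> a \<noteq> 0"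
    and c: "\<And>j. j \<in> \<kappa> ` X \<Longrightarrow> (energy_norm k \<phi> w {x \<in> X. \<kappa> x = j})\<^sup>2 \<le> c * (\<Sum>a\<in>{x \<in> X. \<kappa> x = j}. (w a)\<^sup>2)"
  shows "(energy_norm k \<phi> w X)\<^sup>2 \<le> real (card (\<kappa> ` X)) * c * (\<Sum>a\<in>X. (w a)\<^sup>2)"
proof -
  have "(energy_norm k \<phi> w X)\<^sup>2 \<le> (\<Sum>j\<in>\<kappa> ` X. energy_norm k \<phi> w {x \<in> X. \<kappa> x = j})\<^sup>2"
    by (intro power_mono energy_norm_le_sum_classes energy_norm_nonneg assms)
  also have "\<dots> \<le> (\<Sum>j\<in>\<kappa> ` X. (energy_norm k \<phi> w {x \<in> X. \<kappa> x = j})\<^sup>2) * card (\<kappa> ` X)"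
    by (rule sum_squared_le_sum_of_squares)
  also have "\<dots> \<le> (\<Sum>j\<in>\<kappa> ` X. c * (\<Sum>a\<in>{x \<in> X. \<kappa> x = j}. (w a)\<^sup>2)) * card (\<kappa> ` X)"
    by (intro mult_right_mono sum_mono c) auto
  also have "\<dots> = real (card (\<kappa> ` X)) * c * (\<Sum>a\<in>X. (w a)\<^sup>2)"
    by (simp add: sum_over_classes[OF fin] flip: sum_distrib_left)
  finally show ?thesis .
qed

text \<open>Every solution is counted with the two equal classes pulled out; Hoelder's inequality then leaves
  a factor that cancels.\<close>

lemma energy_norm_sq_le_sum_classes:
  assumes k: "k \<ge> 1" and fin: "finite X" and w: "\<And>a. a \<in> X \<Longrightarrow> w a \<ge> 0"
    and nz: "\<And>a. a \<in> X \<Longrightarrow> \<phi> a \<noteq> 0"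
    and rep: "\<And>b. b \<in> product_solutions k \<phi> (\<lambda>_. X) \<Longrightarrow>
      \<exists>s<2 * k. \<exists>t<2 * k. s \<noteq> t \<and> \<kappa> (b s) = \<kappa> (b t)"
  shows "(energy_norm k \<phi> w X)\<^sup>2 \<le>
    2 * (real k)\<^sup>2 * (\<Sum>j\<in>\<kappa> ` X. (energy_norm k \<phi> w {x \<in> X. \<kappa> x = j})\<^sup>2)"
proof -
  define C where "C j = {x \<in> X. \<kappa> x = j}" for j
  have C: "finite (C j)" "C j \<subseteq> X" for j using fin by (auto simp: C_def)
  define n where "n = energy_norm k \<phi> w X"
  have n0: "n \<ge> 0" unfolding n_def by (intro energy_norm_nonneg w)
  define \<sigma> where "\<sigma> = (\<Sum>j\<in>\<kappa> ` X. (energy_norm k \<phi> w (C j))\<^sup>2)"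
  \<comment> \<open>The pairs s < t of positions: there are k(2k - 1) of them, and this is the
    origin of the factor 2k^2.\<close>
  define P where "P = Sigma {..<2 * k} (\<lambda>t. {..<t})"
  have cP: "card P = (\<Sum>t<2 * k. t)" unfolding P_def by simp
  have "2 * (\<Sum>t<m. t) \<le> m * m" for m :: nat by (induction m) auto
  from this[of "2 * k"] have cP2: "card P \<le> 2 * k * k" unfolding cP by simp
  have finI: "finite (P \<times> \<kappa> ` X)" unfolding P_def using fin by auto
  \<comment> \<open>Positions s and t are confined to the class j, all others remain free and
    contribute the factor n ^ (2k - 2).\<close>
  define V where "V q i = (case q of ((t, s), j) \<Rightarrow> if i = t \<or> i = s then C j else X)" for q :: "(nat \<times> nat) \<times> 'b" and i
  have V: "finite (V q i)" "V q i \<subseteq> X" for q i using C fin by (auto simp: V_def split: prod.splits)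
  have "mixed_energy k \<phi> w (\<lambda>_. X) \<le> (\<Sum>q\<in>P \<times> \<kappa> ` X. mixed_energy k \<phi> w (V q))"
    unfolding mixed_energy_def
  proof (rule sum_le_sum_cover[OF finI])
    show "product_solutions k \<phi> (\<lambda>_. X) \<subseteq> (\<Union>q\<in>P \<times> \<kappa> ` X. product_solutions k \<phi> (V q))"
    proof
      fix b assume b: "b \<in> product_solutions k \<phi> (\<lambda>_. X)"
      obtain s t where "s < 2 * k" "t < 2 * k" "s \<noteq> t" "\<kappa> (b s) = \<kappa> (b t)" using rep[OF b] by blast
      then obtain s t where st: "s < t" "t < 2 * k" "\<kappa> (b s) = \<kappa> (b t)"
        by (cases "s < t") (use linorder_neqE_nat in \<open>metis, metis\<close>)
      have bX: "b i \<in> X" if "i < 2 * k" for i using b that by (auto simp: product_solutions_def PiE_iff)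
      have "((t, s), \<kappa> (b t)) \<in> P \<times> \<kappa> ` X" using st bX by (auto simp: P_def)
      moreover have "b \<in> product_solutions k \<phi> (V ((t, s), \<kappa> (b t)))"
        using b st by (auto simp: V_def C_def product_solutions_def PiE_iff)
      ultimately show "b \<in> (\<Union>q\<in>P \<times> \<kappa> ` X. product_solutions k \<phi> (V q))" by blast
    qed
    show "finite (product_solutions k \<phi> (V q))" for q
      by (intro finite_product_solutions V)
    show "0 \<le> (\<Prod>i<2 * k. w (b i))" if "b \<in> product_solutions k \<phi> (V q)" for b q
    proof (rule prod_nonneg)
      fix i assume "i \<in> {..<2 * k}"
      then have "b i \<in> V q i" using that by (auto simp: product_solutions_def PiE_iff)
      then show "0 \<le> w (b i)" using V(2) w by blast
    qed
  qed
  also have "\<dots> \<le> (\<Sum>q\<in>P \<times> \<kappa> ` X. \<Prod>i<2 * k. energy_norm k \<phi> w (V q i))"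
    by (intro sum_mono mixed_energy_le_prod_energy_norm k V) (use nz V(2) in blast)
  also have "\<dots> = (\<Sum>q\<in>P \<times> \<kappa> ` X. (energy_norm k \<phi> w (C (snd q)))\<^sup>2 * n ^ (2 * k - 2))"
  proof (intro sum.cong refl)
    fix q assume "q \<in> P \<times> \<kappa> ` X"
    then obtain t s j where q: "q = ((t, s), j)" "s < t" "t < 2 * k" by (auto simp: P_def)
    have e: "{..<2 * k} = insert s (insert t ({..<2 * k} - {s, t}))" using q by auto
    have "(\<Prod>i<2 * k. energy_norm k \<phi> w (V q i)) =
      energy_norm k \<phi> w (V q s) * (energy_norm k \<phi> w (V q t) * (\<Prod>i\<in>{..<2 * k} - {s, t}. energy_norm k \<phi> w (V q i)))"
      by (subst e) (use q in simp)
    also have "(\<Prod>i\<in>{..<2 * k} - {s, t}. energy_norm k \<phi> w (V q i)) = (\<Prod>i\<in>{..<2 * k} - {s, t}. n)"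
      by (intro prod.cong refl) (auto simp: V_def q n_def)
    also have "\<dots> = n ^ (2 * k - 2)" using q by (simp add: card_Diff_subset numeral_2_eq_2)
    finally show "(\<Prod>i<2 * k. energy_norm k \<phi> w (V q i)) = (energy_norm k \<phi> w (C (snd q)))\<^sup>2 * n ^ (2 * k - 2)"
      by (simp add: V_def q power2_eq_square)
  qed
  also have "\<dots> = real (card P) * \<sigma> * n ^ (2 * k - 2)"
  proof -
    have "(\<Sum>q\<in>P \<times> \<kappa> ` X. g (snd q)) = (\<Sum>p\<in>P. \<Sum>j\<in>\<kappa> ` X. g j)" for g :: "'b \<Rightarrow> real"
      by (simp add: sum.cartesian_product case_prod_unfold del: sum_constant)
    from this[of "\<lambda>j. (energy_norm k \<phi> w (C j))\<^sup>2"] show ?thesis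
      by (simp add: \<sigma>_def flip: sum_distrib_right)
  qed
  also have "\<dots> \<le> (2 * (real k)\<^sup>2) * \<sigma> * n ^ (2 * k - 2)"
  proof (intro mult_right_mono)
    have "real (card P) \<le> real (2 * k * k)" using cP2 by (rule of_nat_mono)
    then show "real (card P) \<le> 2 * (real k)\<^sup>2" by (simp add: power2_eq_square)
  qed (use n0 in \<open>auto simp: \<sigma>_def intro: sum_nonneg\<close>)
  finally have main: "n ^ (2 * k) \<le> (2 * (real k)\<^sup>2) * \<sigma> * n ^ (2 * k - 2)"
    unfolding n_def using energy_norm_power[of k X w \<phi>] k w by simp
  have "n\<^sup>2 \<le> 2 * (real k)\<^sup>2 * \<sigma>"
  proof (cases "n = 0")
    case True
    then show ?thesis by (auto simp: \<sigma>_def intro!: sum_nonneg mult_nonneg_nonneg)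
  next
    case False
    then have "n ^ (2 * k - 2) > 0" using n0 by simp
    moreover have "n ^ (2 * k) = n\<^sup>2 * n ^ (2 * k - 2)"
    proof -
      have "2 * k = 2 + (2 * k - 2)" using k by simp
      then show ?thesis by (metis power_add)
    qed
    ultimately show ?thesis using main by simp
  qed
  then show ?thesis by (simp add: n_def \<sigma>_def C_def)
qed

lemma energy_norm_le_at_most_one:
  assumes k: "k \<ge> 1" and w: "\<And>a. a \<in> X \<Longrightarrow> w a \<ge> 0"
    and one: "\<And>a b. a \<in> X \<Longrightarrow> b \<in> X \<Longrightarrow> a = b"
  shows "(energy_norm k \<phi> w X)\<^sup>2 \<le> (\<Sum>a\<in>X. (w a)\<^sup>2)"
proof (cases "X = {}")
  case True
  have "product_solutions k \<phi> (\<lambda>_. X) = {}"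
    using True k by (auto simp: product_solutions_def PiE_iff intro: exI[of _ 0])
  then show ?thesis using True k by (simp add: energy_norm_def mixed_energy_def)
next
  case False
  then obtain x where X: "X = {x}" using one by blast
  have x: "w x \<ge> 0" using X w by simp
  have "product_solutions k \<phi> (\<lambda>_. X) \<subseteq> {restrict (\<lambda>_. x) {..<2 * k}}"
    unfolding X product_solutions_def by (auto simp: PiE_iff extensional_def fun_eq_iff)
  then have "mixed_energy k \<phi> w (\<lambda>_. X) \<le> (\<Sum>b\<in>{restrict (\<lambda>_. x) {..<2 * k}}. \<Prod>i<2 * k. w (b i))"
    unfolding mixed_energy_def by (intro sum_mono2) (auto intro!: prod_nonneg x)
  also have "\<dots> = w x ^ (2 * k)" by simp
  finally have "energy_norm k \<phi> w X ^ (2 * k) \<le> w x ^ (2 * k)"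
    using energy_norm_power[of k X w \<phi>] k w by simp
  then have "energy_norm k \<phi> w X \<le> w x"
    using k x energy_norm_nonneg[of X w] w by (subst (asm) power_mono_iff) auto
  then show ?thesis using X energy_norm_nonneg[of X w] w by (auto intro!: power_mono)
qed

text \<open>Every prime costs one factor 2k^2, however many values its valuation takes, because the
  sums of squared weights over the classes add up to the sum over X. The last assumption speaks of
  all subsets Y since the classes are refined prime by prime.\<close>

lemma energy_norm_bound_positive_valuations:
  fixes \<theta> :: "'b \<Rightarrow> rat"
  assumes k: "k \<ge> 1" and "finite Q" "finite X" "\<And>a. a \<in> X \<Longrightarrow> w a \<ge> 0"
    and "\<And>p. p \<in> Q \<Longrightarrow> prime p" "\<And>a. a \<in> X \<Longrightarrow> \<theta> a \<noteq> 0 \<and> 1 + \<theta> a \<noteq> 0"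
    and "\<And>a p. a \<in> X \<Longrightarrow> p \<in> Q \<Longrightarrow> padic_val p (\<theta> a) > 0"
    and "\<And>Y. Y \<subseteq> X \<Longrightarrow> \<forall>p\<in>Q. \<forall>a\<in>Y. \<forall>b\<in>Y. padic_val p (\<theta> a) = padic_val p (\<theta> b) \<Longrightarrow>
      (energy_norm k (\<lambda>a. 1 + \<theta> a) w Y)\<^sup>2 \<le> D * (\<Sum>a\<in>Y. (w a)\<^sup>2)"
  shows "(energy_norm k (\<lambda>a. 1 + \<theta> a) w X)\<^sup>2 \<le> (2 * (real k)\<^sup>2) ^ card Q * D * (\<Sum>a\<in>X. (w a)\<^sup>2)"
  using assms(2-)
proof (induction Q arbitrary: X rule: finite_induct)
  case empty
  then show ?case by simp
next
  case (insert p Q)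
  let ?\<kappa> = "\<lambda>a. padic_val p (\<theta> a)" and ?\<phi> = "\<lambda>a. 1 + \<theta> a"
  define c where "c = (2 * (real k)\<^sup>2) ^ card Q * D"
  have rep: "\<exists>s<2 * k. \<exists>t<2 * k. s \<noteq> t \<and> ?\<kappa> (b s) = ?\<kappa> (b t)"
    if b: "b \<in> product_solutions k ?\<phi> (\<lambda>_. X)" for b
  proof -
    have bX: "b i \<in> X" if "i < 2 * k" for i using b that by (auto simp: product_solutions_def PiE_iff)
    have "\<exists>s\<in>{..<k} \<union> {k..<2 * k}. \<exists>t\<in>{..<k} \<union> {k..<2 * k}. s \<noteq> t \<and> ?\<kappa> (b s) = ?\<kappa> (b t)"
    proof (rule shifted_products_equal_valuations[where a = "\<lambda>i. \<theta> (b i)"])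
      show "prime p" using insert.prems(3) by simp
      show "{..<k} \<inter> {k..<2 * k} = {}" by auto
      show "{..<k} \<union> {k..<2 * k} \<noteq> {}" using k by (auto simp: lessThan_empty_iff)
      show "(\<Prod>i<k. 1 + \<theta> (b i)) = (\<Prod>i=k..<2 * k. 1 + \<theta> (b i))"
        using b by (simp add: product_solutions_def)
      fix i assume "i \<in> {..<k} \<union> {k..<2 * k}"
      then have "b i \<in> X" by (intro bX) auto
      then show "\<theta> (b i) \<noteq> 0 \<and> 1 + \<theta> (b i) \<noteq> 0 \<and> 0 < padic_val p (\<theta> (b i))"
        using insert.prems(4,5) by blast
    qed auto
    then show ?thesis unfolding lessThan_double_split[symmetric] by blast
  qed
  have cls: "(energy_norm k ?\<phi> w {x \<in> X. ?\<kappa> x = j})\<^sup>2 \<le> c * (\<Sum>a\<in>{x \<in> X. ?\<kappa> x = j}. (w a)\<^sup>2)" for j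
    unfolding c_def
  proof (rule insert.IH)
    fix Y assume Y: "Y \<subseteq> {x \<in> X. ?\<kappa> x = j}"
      and "\<forall>p\<in>Q. \<forall>a\<in>Y. \<forall>b\<in>Y. padic_val p (\<theta> a) = padic_val p (\<theta> b)"
    moreover have "\<forall>a\<in>Y. \<forall>b\<in>Y. ?\<kappa> a = ?\<kappa> b" using Y by auto
    ultimately have "\<forall>p\<in>insert p Q. \<forall>a\<in>Y. \<forall>b\<in>Y. padic_val p (\<theta> a) = padic_val p (\<theta> b)"
      by blast
    moreover have "Y \<subseteq> X" using Y by blast
    ultimately show "(energy_norm k ?\<phi> w Y)\<^sup>2 \<le> D * (\<Sum>a\<in>Y. (w a)\<^sup>2)"
      using insert.prems(6)[of Y] by blast
  qed (use insert.prems(1-5) in simp_all)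
  have "(energy_norm k ?\<phi> w X)\<^sup>2 \<le> 2 * (real k)\<^sup>2 * (\<Sum>j\<in>?\<kappa> ` X. (energy_norm k ?\<phi> w {x \<in> X. ?\<kappa> x = j})\<^sup>2)"
    by (intro energy_norm_sq_le_sum_classes k rep) (use insert.prems(1,2,4) in auto)
  also have "\<dots> \<le> 2 * (real k)\<^sup>2 * (\<Sum>j\<in>?\<kappa> ` X. c * (\<Sum>a\<in>{x \<in> X. ?\<kappa> x = j}. (w a)\<^sup>2))"
    by (intro mult_left_mono sum_mono cls) auto
  also have "\<dots> = 2 * (real k)\<^sup>2 * c * (\<Sum>a\<in>X. (w a)\<^sup>2)"
    by (simp add: sum_over_classes[OF insert.prems(1)] flip: sum_distrib_left)
  finally show ?case using insert.hyps by (simp add: c_def mult_ac)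
qed

subsection \<open>Energies of shifted sets of small rank\<close>

lemma prod_second_half: "(\<Prod>i=k..<2 * k. f i) = (\<Prod>i<k. f (k + i))" for f :: "nat \<Rightarrow> 'a::comm_monoid_mult"
  by (rule prod.reindex_bij_witness[of _ "\<lambda>i. k + i" "\<lambda>i. i - k"]) auto

text \<open>At a prime where the valuations of the a's are negative, 1 + a has the valuation of a; together with
  the primes where the valuations are constant this forces equal products of the a's, and
  then of the 1 + 1/a.\<close>

lemma product_solutions_inverse_shift:
  fixes \<alpha> :: "'b \<Rightarrow> rat"
  assumes nz: "\<And>a. a \<in> Y \<Longrightarrow> \<alpha> a \<noteq> 0 \<and> 1 + \<alpha> a \<noteq> 0"
    and span: "\<And>a b. a \<in> Y \<Longrightarrow> b \<in> Y \<Longrightarrow> \<alpha> a / \<alpha> b \<in> mult_span T"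
    and sgn: "\<And>a b. a \<in> Y \<Longrightarrow> b \<in> Y \<Longrightarrow> sgn (\<alpha> a) = sgn (\<alpha> b)"
    and prime: "\<And>p. p \<in> S \<Longrightarrow> prime p"
    and sep: "\<And>q. q \<in> mult_span T \<Longrightarrow> \<forall>p\<in>S. padic_val p q = 0 \<Longrightarrow> \<bar>q\<bar> = 1"
    and val: "\<And>p. p \<in> S \<Longrightarrow> (\<forall>a\<in>Y. padic_val p (\<alpha> a) < 0) \<or>
      (\<forall>a\<in>Y. \<forall>b\<in>Y. padic_val p (\<alpha> a) = padic_val p (\<alpha> b))"
  shows "product_solutions k (\<lambda>a. 1 + \<alpha> a) (\<lambda>_. Y) \<subseteq> product_solutions k (\<lambda>a. 1 + inverse (\<alpha> a)) (\<lambda>_. Y)"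
proof
  fix b assume b: "b \<in> product_solutions k (\<lambda>a. 1 + \<alpha> a) (\<lambda>_. Y)"
  have bY: "b i \<in> Y" if "i < 2 * k" for i using b that by (auto simp: product_solutions_def PiE_iff)
  have eq: "(\<Prod>i<k. 1 + \<alpha> (b i)) = (\<Prod>i=k..<2 * k. 1 + \<alpha> (b i))"
    using b by (simp add: product_solutions_def)
  define u v where "u = (\<Prod>i<k. \<alpha> (b i))" and "v = (\<Prod>i=k..<2 * k. \<alpha> (b i))"
  have nzb: "\<alpha> (b i) \<noteq> 0" "1 + \<alpha> (b i) \<noteq> 0" if "i < 2 * k" for i using nz[OF bY[OF that]] by auto
  have uv: "u \<noteq> 0" "v \<noteq> 0" unfolding u_def v_def using nzb by auto
  \<comment> \<open>Pairing position i with position k + i writes u / v as a product of ratios, and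
    only ratios are known to lie in the span of T.\<close>
  have q: "u / v = (\<Prod>i<k. \<alpha> (b i) / \<alpha> (b (k + i)))"
    unfolding u_def v_def prod_second_half by (simp add: prod_dividef)
  have "u / v \<in> mult_span T"
    unfolding q by (intro mult_span_prod span bY) auto
  moreover have "padic_val p (u / v) = 0" if p: "p \<in> S" for p
  proof -
    have vu: "padic_val p u = (\<Sum>i<k. padic_val p (\<alpha> (b i)))"
      unfolding u_def by (rule padic_val_prod[OF prime[OF p]]) (use nzb in auto)
    have vv: "padic_val p v = (\<Sum>i=k..<2 * k. padic_val p (\<alpha> (b i)))"
      unfolding v_def by (rule padic_val_prod[OF prime[OF p]]) (use nzb in auto)
    have "padic_val p u = padic_val p v"
      using val[OF p]
    proof
      assume neg: "\<forall>a\<in>Y. padic_val p (\<alpha> a) < 0"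
      have s: "padic_val p (\<alpha> (b i)) = padic_val p (1 + \<alpha> (b i))" if "i < 2 * k" for i
        using padic_val_shift_one_neg[OF prime[OF p] nzb[OF that]] neg bY[OF that] by simp
      have "padic_val p u = (\<Sum>i<k. padic_val p (1 + \<alpha> (b i)))"
        unfolding vu by (intro sum.cong refl s) auto
      also have "\<dots> = padic_val p (\<Prod>i<k. 1 + \<alpha> (b i))"
        by (rule padic_val_prod[symmetric, OF prime[OF p]]) (use nzb in auto)
      also have "\<dots> = (\<Sum>i=k..<2 * k. padic_val p (1 + \<alpha> (b i)))"
        unfolding eq by (rule padic_val_prod[OF prime[OF p]]) (use nzb in auto)
      also have "\<dots> = padic_val p v"
        unfolding vv by (intro sum.cong refl s[symmetric]) auto
      finally show ?thesis .
    next
      \<comment> \<open>Both sides have k factors, so equal valuations give equal sums.\<close>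
      assume const: "\<forall>a\<in>Y. \<forall>b\<in>Y. padic_val p (\<alpha> a) = padic_val p (\<alpha> b)"
      have "padic_val p u = (\<Sum>i<k. padic_val p (\<alpha> (b 0)))"
        unfolding vu by (intro sum.cong refl) (use const bY in auto)
      moreover have "padic_val p v = (\<Sum>i=k..<2 * k. padic_val p (\<alpha> (b 0)))"
        unfolding vv by (intro sum.cong refl) (use const bY in auto)
      ultimately show ?thesis by simp
    qed
    then show ?thesis using padic_val_divide[OF prime[OF p]] uv by simp
  qed
  ultimately have "\<bar>u / v\<bar> = 1" by (intro sep) auto
  \<comment> \<open>The valuations determine u / v only up to sign; the common sign of the \<alpha>
    settles the rest.\<close>
  moreover have "u / v > 0"
    unfolding q
  proof (rule prod_pos)
    fix i assume "i \<in> {..<k}"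
    then have i: "i < 2 * k" "k + i < 2 * k" by auto
    have "sgn (\<alpha> (b i)) = sgn (\<alpha> (b (k + i)))" using sgn bY i by blast
    then show "0 < \<alpha> (b i) / \<alpha> (b (k + i))"
      using nzb(1)[OF i(1)] nzb(1)[OF i(2)] by (auto simp: sgn_if zero_less_divide_iff split: if_splits)
  qed
  ultimately have "u / v = 1" by (metis abs_of_pos)
  then have "u = v" using uv by simp
  have "(\<Prod>i<k. 1 + inverse (\<alpha> (b i))) = (\<Prod>i<k. 1 + \<alpha> (b i)) / u"
    unfolding u_def prod_dividef[symmetric] by (intro prod.cong refl) (use nzb in \<open>simp add: field_simps\<close>)
  moreover have "(\<Prod>i=k..<2 * k. 1 + inverse (\<alpha> (b i))) = (\<Prod>i=k..<2 * k. 1 + \<alpha> (b i)) / v"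
    unfolding v_def prod_dividef[symmetric] by (intro prod.cong refl) (use nzb in \<open>simp add: field_simps\<close>)
  ultimately have "(\<Prod>i<k. 1 + inverse (\<alpha> (b i))) = (\<Prod>i=k..<2 * k. 1 + inverse (\<alpha> (b i)))"
    using eq \<open>u = v\<close> by simp
  then show "b \<in> product_solutions k (\<lambda>a. 1 + inverse (\<alpha> a)) (\<lambda>_. Y)"
    using b by (simp add: product_solutions_def)
qed

text \<open>Each prime of S is paid for at most once: before the inversion if its valuations are
  positive on X, after it if they are negative, and not at all if they vanish. Hence the exponent
  \<open>card S\<close>.\<close>

lemma energy_norm_bound_homogeneous:
  fixes \<alpha> :: "'b \<Rightarrow> rat"
  assumes k: "k \<ge> 1" and fin: "finite X" "finite S" and w: "\<And>a. a \<in> X \<Longrightarrow> w a \<ge> 0"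
    and inj: "inj_on \<alpha> X"
    and nz: "\<And>a. a \<in> X \<Longrightarrow> \<alpha> a \<noteq> 0 \<and> 1 + \<alpha> a \<noteq> 0"
    and span: "\<And>a b. a \<in> X \<Longrightarrow> b \<in> X \<Longrightarrow> \<alpha> a / \<alpha> b \<in> mult_span T"
    and sgn: "\<And>a b. a \<in> X \<Longrightarrow> b \<in> X \<Longrightarrow> sgn (\<alpha> a) = sgn (\<alpha> b)"
    and prime: "\<And>p. p \<in> S \<Longrightarrow> prime p"
    and sep: "\<And>q. q \<in> mult_span T \<Longrightarrow> \<forall>p\<in>S. padic_val p q = 0 \<Longrightarrow> \<bar>q\<bar> = 1"
    and sgv: "\<And>p a b. p \<in> S \<Longrightarrow> a \<in> X \<Longrightarrow> b \<in> X \<Longrightarrow> sgn (padic_val p (\<alpha> a)) = sgn (padic_val p (\<alpha> b))"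
  shows "(energy_norm k (\<lambda>a. 1 + \<alpha> a) w X)\<^sup>2 \<le> (2 * (real k)\<^sup>2) ^ card S * (\<Sum>a\<in>X. (w a)\<^sup>2)"
proof (cases "X = {}")
  case True
  then show ?thesis using energy_norm_le_at_most_one[of k X w "\<lambda>a. 1 + \<alpha> a"] k by simp
next
  case False
  then obtain x where x: "x \<in> X" by blast
  define c where "c = 2 * (real k)\<^sup>2"
  have "(real k)\<^sup>2 \<ge> 1" using k by (simp add: one_le_power)
  then have c1: "c \<ge> 1" by (simp add: c_def)
  define P N where "P = {p \<in> S. padic_val p (\<alpha> x) > 0}" and "N = {p \<in> S. padic_val p (\<alpha> x) < 0}"
  have PN: "finite P" "finite N" "P \<subseteq> S" "N \<subseteq> S" using fin by (auto simp: P_def N_def)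
  have posP: "padic_val p (\<alpha> a) > 0" if "p \<in> P" "a \<in> X" for p a
  proof -
    have "p \<in> S" "padic_val p (\<alpha> x) > 0" using that by (auto simp: P_def)
    then show ?thesis using sgv[of p a x] that(2) x by (simp add: sgn_1_pos)
  qed
  have negN: "padic_val p (\<alpha> a) < 0" if "p \<in> N" "a \<in> X" for p a
  proof -
    have "p \<in> S" "padic_val p (\<alpha> x) < 0" using that by (auto simp: N_def)
    then show ?thesis using sgv[of p a x] that(2) x by (simp add: sgn_1_neg)
  qed
  have zero: "padic_val p (\<alpha> a) = 0" if "p \<in> S" "p \<notin> P" "p \<notin> N" "a \<in> X" for p a
  proof -
    have "padic_val p (\<alpha> x) = 0" using that by (auto simp: P_def N_def)
    then show ?thesis using sgv[of p a x] that x by (simp add: sgn_0_0)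
  qed
  have "(energy_norm k (\<lambda>a. 1 + \<alpha> a) w X)\<^sup>2 \<le> c ^ card P * c ^ card N * (\<Sum>a\<in>X. (w a)\<^sup>2)"
    unfolding c_def
  proof (rule energy_norm_bound_positive_valuations[OF k])
    fix Y assume YX: "Y \<subseteq> X" and Y: "\<forall>p\<in>P. \<forall>a\<in>Y. \<forall>b\<in>Y. padic_val p (\<alpha> a) = padic_val p (\<alpha> b)"
    have finY: "finite Y" using YX fin finite_subset by blast
    have wY: "w a \<ge> 0" if "a \<in> Y" for a using w YX that by blast
    have nzY: "\<alpha> a \<noteq> 0 \<and> 1 + \<alpha> a \<noteq> 0" if "a \<in> Y" for a using nz YX that by blast
    have "product_solutions k (\<lambda>a. 1 + \<alpha> a) (\<lambda>_. Y) \<subseteq> product_solutions k (\<lambda>a. 1 + inverse (\<alpha> a)) (\<lambda>_. Y)"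
    proof (rule product_solutions_inverse_shift[where S = S and T = T])
      fix p assume p: "p \<in> S"
      show "(\<forall>a\<in>Y. padic_val p (\<alpha> a) < 0) \<or> (\<forall>a\<in>Y. \<forall>b\<in>Y. padic_val p (\<alpha> a) = padic_val p (\<alpha> b))"
      proof (cases "p \<in> N")
        case True
        then show ?thesis using negN YX by blast
      next
        case False
        then show ?thesis
          by (cases "p \<in> P") (use Y zero[OF p _ False] YX in \<open>blast, metis subset_iff\<close>)
      qed
    qed (use nzY span sgn prime sep YX in blast)+
    then have "(energy_norm k (\<lambda>a. 1 + \<alpha> a) w Y)\<^sup>2 \<le> (energy_norm k (\<lambda>a. 1 + inverse (\<alpha> a)) w Y)\<^sup>2"
      by (intro power_mono energy_norm_mono energy_norm_nonneg k finY wY)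
    also have "\<dots> \<le> (2 * (real k)\<^sup>2) ^ card N * 1 * (\<Sum>a\<in>Y. (w a)\<^sup>2)"
    proof (rule energy_norm_bound_positive_valuations[OF k PN(2) finY wY])
      show "prime p" if "p \<in> N" for p using that PN prime by blast
      show "inverse (\<alpha> a) \<noteq> 0 \<and> 1 + inverse (\<alpha> a) \<noteq> 0" if "a \<in> Y" for a
      proof -
        have "1 + inverse (\<alpha> a) = (1 + \<alpha> a) / \<alpha> a" using nzY[OF that] by (simp add: field_simps)
        then show ?thesis using nzY[OF that] by simp
      qed
      show "padic_val p (inverse (\<alpha> a)) > 0" if "a \<in> Y" "p \<in> N" for a p
      proof -
        have "prime p" "a \<in> X" using that PN prime YX by auto
        then show ?thesis using padic_val_inverse[of p "\<alpha> a"] nzY[OF that(1)] negN[OF that(2)] by simp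
      qed
      fix Z assume ZY: "Z \<subseteq> Y"
        and Z: "\<forall>p\<in>N. \<forall>a\<in>Z. \<forall>b\<in>Z. padic_val p (inverse (\<alpha> a)) = padic_val p (inverse (\<alpha> b))"
      \<comment> \<open>On Z the valuations at all primes of S are constant, so the ratio of two
        values has absolute value 1; equal signs and injectivity leave at most one index.\<close>
      have ab: "a = b" if "a \<in> Z" "b \<in> Z" for a b
      proof -
        have abY: "a \<in> Y" "b \<in> Y" and abX: "a \<in> X" "b \<in> X" using that ZY YX by auto
        have "padic_val p (\<alpha> a / \<alpha> b) = 0" if p: "p \<in> S" for p
        proof -
          have pr: "prime p" using prime[OF p] .
          have "padic_val p (\<alpha> a) = padic_val p (\<alpha> b)"
          proof (cases "p \<in> N")
            case True
            then have "padic_val p (inverse (\<alpha> a)) = padic_val p (inverse (\<alpha> b))"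
              using Z \<open>a \<in> Z\<close> \<open>b \<in> Z\<close> by blast
            then show ?thesis using padic_val_inverse[OF pr] nzY abY by simp
          next
            case False
            show ?thesis
            proof (cases "p \<in> P")
              case True
              then show ?thesis using Y abY by blast
            qed (use zero[OF p _ False] abX in simp)
          qed
          then show ?thesis using padic_val_divide[OF pr] nzY abY by simp
        qed
        then have "\<bar>\<alpha> a / \<alpha> b\<bar> = 1" using sep span abX by blast
        moreover have "sgn (\<alpha> a) = sgn (\<alpha> b)" using sgn abX by blast
        moreover have "\<bar>\<alpha> a\<bar> = \<bar>\<alpha> b\<bar>" if "\<bar>\<alpha> a / \<alpha> b\<bar> = 1"
          using that nzY[OF abY(2)] by (simp add: abs_divide)
        ultimately have "\<alpha> a = \<alpha> b" by (metis mult_sgn_abs)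
        then show ?thesis using inj abX by (auto dest: inj_onD)
      qed
      have "(energy_norm k (\<lambda>a. 1 + inverse (\<alpha> a)) w Z)\<^sup>2 \<le> (\<Sum>a\<in>Z. (w a)\<^sup>2)"
        by (rule energy_norm_le_at_most_one[OF k]) (use wY ZY ab in blast)+
      then show "(energy_norm k (\<lambda>a. 1 + inverse (\<alpha> a)) w Z)\<^sup>2 \<le> 1 * (\<Sum>a\<in>Z. (w a)\<^sup>2)" by simp
    qed
    finally show "(energy_norm k (\<lambda>a. 1 + \<alpha> a) w Y)\<^sup>2 \<le> (2 * (real k)\<^sup>2) ^ card N * (\<Sum>a\<in>Y. (w a)\<^sup>2)" by simp
  qed (use fin PN w prime nz posP in auto)
  also have "\<dots> \<le> c ^ card S * (\<Sum>a\<in>X. (w a)\<^sup>2)"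
  proof (intro mult_right_mono sum_nonneg)
    have "P \<inter> N = {}" by (auto simp: P_def N_def)
    then have "card P + card N = card (P \<union> N)" using PN by (simp add: card_Un_disjoint)
    also have "\<dots> \<le> card S" using fin PN by (intro card_mono) auto
    finally show "c ^ card P * c ^ card N \<le> c ^ card S"
      using c1 by (simp flip: power_add add: power_increasing)
  qed auto
  finally show ?thesis by (simp add: c_def)
qed

text \<open>There are at most 3 * 3^(card S) sign patterns, and multiplying by (2k^2)^(card S) for
  each gives the constant. The value 0 has the sign 0 and so forms its own class, where injectivity
  replaces the argument by valuations.\<close>

lemma energy_norm_bound_rank:
  fixes \<alpha> :: "'b \<Rightarrow> rat"
  assumes k: "k \<ge> 1" and fin: "finite X" and w: "\<And>a. a \<in> X \<Longrightarrow> w a \<ge> 0"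
    and inj: "inj_on \<alpha> X" and nz: "\<And>a. a \<in> X \<Longrightarrow> 1 + \<alpha> a \<noteq> 0"
    and T: "ratios_spanned (\<alpha> ` X - {0}) T"
  shows "(energy_norm k (\<lambda>a. 1 + \<alpha> a) w X)\<^sup>2 \<le> 3 * (6 * (real k)\<^sup>2) ^ card T * (\<Sum>a\<in>X. (w a)\<^sup>2)"
proof -
  obtain S where S: "finite S" "card S \<le> card T" "\<forall>p\<in>S. prime p"
    "\<forall>q\<in>mult_span T. (\<forall>p\<in>S. padic_val p q = 0) \<longrightarrow> \<bar>q\<bar> = 1"
    using mult_span_separating_primes[of T] T by (auto simp: ratios_spanned_def)
  have span: "\<alpha> a / \<alpha> b \<in> mult_span T" if "a \<in> X" "b \<in> X" "\<alpha> a \<noteq> 0" "\<alpha> b \<noteq> 0" for a b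
    using T that by (auto simp: ratios_spanned_def)
  define \<kappa> where "\<kappa> a = (sgn (\<alpha> a), restrict (\<lambda>p. sgn (padic_val p (\<alpha> a))) S)" for a
  define c where "c = (2 * (real k)\<^sup>2) ^ card S"
  have k2: "(real k)\<^sup>2 \<ge> 1" using k by (simp add: one_le_power)
  have c1: "c \<ge> 1" unfolding c_def using k2 by (intro one_le_power) simp
  have "(energy_norm k (\<lambda>a. 1 + \<alpha> a) w X)\<^sup>2 \<le> real (card (\<kappa> ` X)) * c * (\<Sum>a\<in>X. (w a)\<^sup>2)"
  proof (rule energy_norm_bound_classes[OF k fin])
    fix j assume "j \<in> \<kappa> ` X"
    define Y where "Y = {x \<in> X. \<kappa> x = j}"
    have YX: "Y \<subseteq> X" by (auto simp: Y_def)
    have finY: "finite Y" using YX fin finite_subset by blast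
    have wY: "w a \<ge> 0" if "a \<in> Y" for a using w YX that by blast
    have same: "\<kappa> a = \<kappa> b" if "a \<in> Y" "b \<in> Y" for a b using that by (simp add: Y_def)
    have sgn: "sgn (\<alpha> a) = sgn (\<alpha> b)" if "a \<in> Y" "b \<in> Y" for a b
      using same[OF that] by (simp add: \<kappa>_def)
    have sgv: "sgn (padic_val p (\<alpha> a)) = sgn (padic_val p (\<alpha> b))" if "p \<in> S" "a \<in> Y" "b \<in> Y" for p a b
    proof -
      have "snd (\<kappa> a) p = snd (\<kappa> b) p" using same[OF that(2,3)] by simp
      then show ?thesis using that(1) by (simp add: \<kappa>_def)
    qed
    have injY: "inj_on \<alpha> Y" using inj YX inj_on_subset by blast
    have "(energy_norm k (\<lambda>a. 1 + \<alpha> a) w Y)\<^sup>2 \<le> c * (\<Sum>a\<in>Y. (w a)\<^sup>2)"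
    proof (cases "\<exists>a\<in>Y. \<alpha> a = 0")
      case True
      then have z: "\<alpha> a = 0" if "a \<in> Y" for a using sgn[OF that] by (metis sgn_0_0 sgn_0)
      have "(energy_norm k (\<lambda>a. 1 + \<alpha> a) w Y)\<^sup>2 \<le> (\<Sum>a\<in>Y. (w a)\<^sup>2)"
      proof (rule energy_norm_le_at_most_one[OF k wY])
        show "a = b" if "a \<in> Y" "b \<in> Y" for a b
          by (rule inj_onD[OF injY _ that]) (simp add: z that)
      qed
      also have "\<dots> \<le> c * (\<Sum>a\<in>Y. (w a)\<^sup>2)"
        using mult_right_mono[OF c1, of "\<Sum>a\<in>Y. (w a)\<^sup>2"] by (simp add: sum_nonneg)
      finally show ?thesis .
    next
      case False
      show ?thesis unfolding c_def
      proof (rule energy_norm_bound_homogeneous[OF k finY S(1) wY injY _ _ sgn])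
        show "\<alpha> a \<noteq> 0 \<and> 1 + \<alpha> a \<noteq> 0" if "a \<in> Y" for a using that False nz YX by blast
        show "\<alpha> a / \<alpha> b \<in> mult_span T" if "a \<in> Y" "b \<in> Y" for a b
          using that False YX by (intro span) auto
        show "prime p" if "p \<in> S" for p using S(3) that by blast
        show "\<bar>q\<bar> = 1" if "q \<in> mult_span T" "\<forall>p\<in>S. padic_val p q = 0" for q using S(4) that by blast
      qed (use sgv in blast)+
    qed
    then show "(energy_norm k (\<lambda>a. 1 + \<alpha> a) w {x \<in> X. \<kappa> x = j})\<^sup>2 \<le> c * (\<Sum>a\<in>{x \<in> X. \<kappa> x = j}. (w a)\<^sup>2)"
      by (simp add: Y_def)
  qed (use w nz in auto)
  also have "\<dots> \<le> (3 * 3 ^ card S) * c * (\<Sum>a\<in>X. (w a)\<^sup>2)"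
  proof (intro mult_right_mono sum_nonneg)
    have "\<kappa> ` X \<subseteq> {-1, 0, 1} \<times> (S \<rightarrow>\<^sub>E {-1, 0, 1})"
      by (auto simp: \<kappa>_def sgn_if split: if_splits)
    then have "card (\<kappa> ` X) \<le> card (({-1, 0, 1} :: rat set) \<times> (S \<rightarrow>\<^sub>E ({-1, 0, 1} :: int set)))"
      using S(1) by (intro card_mono) (auto intro: finite_PiE)
    also have "\<dots> = 3 * 3 ^ card S"
      using S(1) by (simp add: card_cartesian_product card_PiE numeral_3_eq_3)
    finally have "real (card (\<kappa> ` X)) \<le> real (3 * 3 ^ card S)" by (rule of_nat_mono)
    then show "real (card (\<kappa> ` X)) \<le> 3 * 3 ^ card S" by simp
  qed (use c1 in auto)
  also have "(3 * 3 ^ card S) * c = 3 * (6 * (real k)\<^sup>2) ^ card S"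
    using power_mult_distrib[of 3 "2 * (real k)\<^sup>2" "card S"] by (auto simp: c_def mult.assoc)
  also have "\<dots> * (\<Sum>a\<in>X. (w a)\<^sup>2) \<le> 3 * (6 * (real k)\<^sup>2) ^ card T * (\<Sum>a\<in>X. (w a)\<^sup>2)"
    using k2 S(2) by (intro mult_right_mono mult_left_mono power_increasing sum_nonneg) auto
  finally show ?thesis .
qed

subsection \<open>Small doubling\<close>

lemma weighted_energy_eq_mixed: "weighted_energy k w B = mixed_energy k (\<lambda>b. b) w (\<lambda>_. B)"
  by (simp add: weighted_energy_def mixed_energy_def product_solutions_def)

lemma root_weighted_energy:
  assumes "k \<ge> 1" "\<And>b. b \<in> B \<Longrightarrow> w b \<ge> 0"
  shows "root k (weighted_energy k w B) = (energy_norm k (\<lambda>b. b) w B)\<^sup>2"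
proof -
  have "mixed_energy k (\<lambda>b. b) w (\<lambda>_. B) \<ge> 0" by (rule mixed_energy_nonneg) (use assms in auto)
  then show ?thesis using assms(1)
    by (simp add: weighted_energy_eq_mixed energy_norm_def real_root_mult_exp real_root_pow_pos2)
qed

lemma Lambda_const_le:
  assumes "k \<ge> 1" "finite B" "C \<ge> 0"
    and "\<And>w. (\<And>b. b \<in> B \<Longrightarrow> w b \<ge> 0) \<Longrightarrow> (energy_norm k (\<lambda>b. b) w B)\<^sup>2 \<le> C * (\<Sum>b\<in>B. (w b)\<^sup>2)"
  shows "Lambda_const k B \<le> C"
proof (cases "B = {}")
  case True
  then show ?thesis using assms(3) by (simp add: Lambda_const_def)
next
  case False
  then obtain w where w: "w \<in> unit_weights B" "Lambda_const k B = root k (weighted_energy k w B)"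
    using Lambda_const_attained[OF assms(2)] by blast
  have w0: "\<And>b. b \<in> B \<Longrightarrow> w b \<ge> 0" and w1: "(\<Sum>b\<in>B. (w b)\<^sup>2) = 1"
    using w(1) by (auto simp: unit_weights_def)
  have "Lambda_const k B = (energy_norm k (\<lambda>b. b) w B)\<^sup>2"
    unfolding w(2) by (rule root_weighted_energy[OF assms(1)]) (rule w0)
  also have "\<dots> \<le> C * (\<Sum>b\<in>B. (w b)\<^sup>2)" by (rule assms(4)) (rule w0)
  finally show ?thesis using w1 by simp
qed

text \<open>Cauchy-Schwarz for the number r(x) of representations of x as a product of k elements:
  the r(x) sum to |B|^k, and their squares to the energy with all weights 1.\<close>

lemma card_power_le_kfold_product_set:
  fixes B :: "rat set"
  assumes k: "k \<ge> 1" and fin: "finite B" and ne: "B \<noteq> {}"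
    and C: "(energy_norm k (\<lambda>b. b) (\<lambda>_. 1) B)\<^sup>2 \<le> C * real (card B)"
  shows "finite (kfold_product_set k B)" "real (card B) ^ k \<le> C ^ k * real (card (kfold_product_set k B))"
proof -
  define F where "F = {..<k} \<rightarrow>\<^sub>E B"
  define \<pi> where "\<pi> f = (\<Prod>i<k. f i)" for f :: "nat \<Rightarrow> rat"
  have finF: "finite F" unfolding F_def using fin by (intro finite_PiE) auto
  have img: "kfold_product_set k B = \<pi> ` F"
  proof safe
    fix x assume "x \<in> kfold_product_set k B"
    then obtain f where f: "x = (\<Prod>i<k. f i)" "\<forall>i<k. f i \<in> B" by (auto simp: kfold_product_set_def)
    then have "x = \<pi> (restrict f {..<k})" "restrict f {..<k} \<in> F" by (auto simp: \<pi>_def F_def)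
    then show "x \<in> \<pi> ` F" by blast
  next
    fix f assume "f \<in> F"
    then have "\<forall>i<k. f i \<in> B" by (auto simp: F_def PiE_iff)
    then show "\<pi> f \<in> kfold_product_set k B" by (auto simp: kfold_product_set_def \<pi>_def)
  qed
  show finK: "finite (kfold_product_set k B)" using img finF by simp
  define R where "R x = {f \<in> F. \<pi> f = x}" for x
  have finR: "finite (R x)" for x using finF by (simp add: R_def)
  define S where "S = product_solutions k (\<lambda>b. b) (\<lambda>_. B)"
  have finS: "finite S" unfolding S_def using fin by (intro finite_product_solutions)
  have "real (card B) ^ k = real (card F)" by (simp add: F_def card_PiE)
  also have "card F = (\<Sum>x\<in>\<pi> ` F. card (R x))"
    using sum.image_gen[OF finF, of "\<lambda>_. 1 :: nat" \<pi>] by (simp add: R_def)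
  finally have cF: "real (card B) ^ k = (\<Sum>x\<in>\<pi> ` F. real (card (R x)))" by simp
  have "(\<Sum>x\<in>\<pi> ` F. card (R x) * card (R x)) = card (SIGMA x:\<pi> ` F. R x \<times> R x)"
    using finF finR by (simp add: card_cartesian_product)
  also have "\<dots> \<le> card S"
  proof (rule card_inj_on_le[OF _ _ finS])
    \<comment> \<open>Two representations of the same x are glued into one 2k-tuple; the value
      \<open>undefined\<close> beyond 2k makes it extensional.\<close>
    define h where "h = (\<lambda>(x :: rat, f, g). \<lambda>i :: nat. if i < k then f i else if i < 2 * k then g (i - k) else (undefined :: rat))"
    have low: "h (x, f, g) i = f i" if "i < k" for x f g i using that by (simp add: h_def)
    have high: "h (x, f, g) (k + i) = g i" if "i < k" for x f g i using that by (simp add: h_def)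
    show "inj_on h (SIGMA x:\<pi> ` F. R x \<times> R x)"
    proof (rule inj_onI)
      fix p q assume "p \<in> (SIGMA x:\<pi> ` F. R x \<times> R x)" "q \<in> (SIGMA x:\<pi> ` F. R x \<times> R x)" and hh: "h p = h q"
      then obtain x f g y f' g' where p: "p = (x, f, g)" "f \<in> F" "g \<in> F" "\<pi> f = x"
        and q: "q = (y, f', g')" "f' \<in> F" "g' \<in> F" "\<pi> f' = y"
        by (auto simp: R_def)
      have "f i = f' i" if "i < k" for i
        using fun_cong[OF hh, of i] low[OF that] by (simp add: p q)
      then have "f = f'" using p q unfolding F_def by (intro PiE_ext[of f _ _ f']) auto
      moreover have "g i = g' i" if "i < k" for i
        using fun_cong[OF hh, of "k + i"] high[OF that] by (simp add: p q)
      then have "g = g'" using p q unfolding F_def by (intro PiE_ext[of g _ _ g']) auto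
      ultimately show "p = q" using p q by simp
    qed
    show "h ` (SIGMA x:\<pi> ` F. R x \<times> R x) \<subseteq> S"
    proof
      fix b assume "b \<in> h ` (SIGMA x:\<pi> ` F. R x \<times> R x)"
      then obtain x f g where b: "b = h (x, f, g)" "f \<in> F" "g \<in> F" "\<pi> f = x" "\<pi> g = x"
        by (auto simp: R_def)
      have "(\<Prod>i<k. b i) = \<pi> f" unfolding \<pi>_def b by (intro prod.cong refl low) auto
      moreover have "(\<Prod>i=k..<2 * k. b i) = \<pi> g"
        unfolding \<pi>_def b prod_second_half by (intro prod.cong refl high) auto
      moreover have "b \<in> {..<2 * k} \<rightarrow>\<^sub>E B"
        using b(2,3) by (auto simp: b(1) h_def F_def PiE_iff extensional_def)
      ultimately show "b \<in> S" using b by (simp add: S_def product_solutions_def)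
    qed
  qed
  also have "real (card S) = mixed_energy k (\<lambda>b. b) (\<lambda>_. 1) (\<lambda>_. B)"
    by (simp add: mixed_energy_def S_def)
  also have "\<dots> = ((energy_norm k (\<lambda>b. b) (\<lambda>_. 1) B)\<^sup>2) ^ k"
    using energy_norm_power[OF k, of B "\<lambda>_. 1" "\<lambda>b. b"] by (simp add: power_mult)
  also have "\<dots> \<le> (C * real (card B)) ^ k" using C by (intro power_mono) auto
  finally have sq: "(\<Sum>x\<in>\<pi> ` F. (real (card (R x)))\<^sup>2) \<le> C ^ k * real (card B) ^ k"
    by (simp add: power2_eq_square power_mult_distrib)
  have "(real (card B) ^ k)\<^sup>2 \<le> (\<Sum>x\<in>\<pi> ` F. (real (card (R x)))\<^sup>2) * card (\<pi> ` F)"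
    unfolding cF by (rule sum_squared_le_sum_of_squares)
  also have "\<dots> \<le> C ^ k * real (card B) ^ k * card (\<pi> ` F)"
    using sq by (intro mult_right_mono) auto
  finally have "real (card B) ^ k * real (card B) ^ k \<le> real (card B) ^ k * (C ^ k * card (\<pi> ` F))"
    by (simp add: power2_eq_square mult_ac)
  moreover have "real (card B) ^ k > 0" using fin ne by (simp add: card_gt_0_iff)
  ultimately show "real (card B) ^ k \<le> C ^ k * real (card (kfold_product_set k B))"
    using img by simp
qed

text \<open>If the rank is at least n, Freiman's lemma for A without 0 gives (n+1)(|A| - 1) - n(n+1)
  <= n|A|, that is |A| <= (n+1)^2. The -1 accounts for a possible element 0.\<close>

lemma small_doubling_rank:
  fixes A :: "rat set"
  assumes "finite A" "int (card (product_set A A)) \<le> int n * int (card A)"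
  shows "card A \<le> (n + 1)\<^sup>2 \<or> (\<exists>T. ratios_spanned (A - {0}) T \<and> card T < n)"
proof (cases "\<exists>T. ratios_spanned (A - {0}) T \<and> card T < n")
  case False
  let ?A = "A - {0}"
  have "int (card (product_set ?A ?A)) \<ge> (int n + 1) * int (card ?A) - int n * (int n + 1)"
    by (rule freiman_product_set) (use assms(1) False in \<open>auto simp: not_less\<close>)
  moreover have "card (product_set ?A ?A) \<le> card (product_set A A)"
    by (rule card_mono[OF finite_product_set]) (use assms(1) in \<open>auto simp: product_set_def\<close>)
  moreover have "(int n + 1) * (int (card A) - 1) \<le> (int n + 1) * int (card ?A)"
    using assms(1) by (intro mult_left_mono) (auto simp: card_Diff_singleton_if)
  ultimately have "(int n + 1) * (int (card A) - 1) - int n * (int n + 1) \<le> int n * int (card A)"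
    using assms(2) by linarith
  then have "int (card A) \<le> int ((n + 1)\<^sup>2)" by (simp add: algebra_simps power2_eq_square)
  then have "card A \<le> (n + 1)\<^sup>2" by (simp only: of_nat_le_iff)
  then show ?thesis ..
qed simp

lemma card_shift_one: "card (shift_one A) = card A" for A :: "rat set"
proof -
  have "shift_one A = (\<lambda>a. a + 1) ` A" by (auto simp: shift_one_def)
  then show ?thesis by (simp add: card_image)
qed

lemma energy_norm_bound_shift_one:
  fixes A :: "rat set"
  assumes k: "k \<ge> 1" and fin: "finite A" and "-1 \<notin> A" and T: "ratios_spanned (A - {0}) T"
    and w: "\<And>b. b \<in> shift_one A \<Longrightarrow> w b \<ge> 0"
  shows "(energy_norm k (\<lambda>b. b) w (shift_one A))\<^sup>2
    \<le> 3 * (6 * (real k)\<^sup>2) ^ card T * (\<Sum>b\<in>shift_one A. (w b)\<^sup>2)"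
proof -
  have s: "shift_one A = (\<lambda>a. a + 1) ` A" by (auto simp: shift_one_def)
  have "(\<lambda>b. b - 1) ` shift_one A = A" by (force simp: s)
  then have "(energy_norm k (\<lambda>b. 1 + (b - 1)) w (shift_one A))\<^sup>2
    \<le> 3 * (6 * (real k)\<^sup>2) ^ card T * (\<Sum>b\<in>shift_one A. (w b)\<^sup>2)"
    using assms by (intro energy_norm_bound_rank k w) (auto simp: s inj_on_def eq_neg_iff_add_eq_0)
  then show ?thesis by simp
qed

lemma energy_norm_bound_card:
  assumes "k \<ge> 1" "finite B" "\<And>b. b \<in> B \<Longrightarrow> w b \<ge> 0" "\<And>b. b \<in> B \<Longrightarrow> \<phi> b \<noteq> 0"
  shows "(energy_norm k \<phi> w B)\<^sup>2 \<le> real (card B) * (\<Sum>b\<in>B. (w b)\<^sup>2)"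
proof -
  have "(energy_norm k \<phi> w B)\<^sup>2 \<le> real (card ((\<lambda>b. b) ` B)) * 1 * (\<Sum>b\<in>B. (w b)\<^sup>2)"
  proof (rule energy_norm_bound_classes)
    fix j
    have "(energy_norm k \<phi> w {x \<in> B. x = j})\<^sup>2 \<le> (\<Sum>a\<in>{x \<in> B. x = j}. (w a)\<^sup>2)"
      by (rule energy_norm_le_at_most_one) (use assms in auto)
    then show "(energy_norm k \<phi> w {x \<in> B. x = j})\<^sup>2 \<le> 1 * (\<Sum>a\<in>{x \<in> B. x = j}. (w a)\<^sup>2)" by simp
  qed (use assms in auto)
  then show ?thesis by simp
qed

text \<open>Compares the cardinality in the case of few elements with the claimed constant, whose
  base 8k^4 is at least 8.\<close>

lemma square_le_eight_power: "n \<ge> 1 \<Longrightarrow> (n + 1)\<^sup>2 \<le> (8 :: nat) ^ n"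
proof (induction n rule: nat_induct_at_least)
  case (Suc n)
  have "(Suc n + 1)\<^sup>2 \<le> 8 * (n + 1)\<^sup>2" by (simp add: power2_eq_square algebra_simps)
  then show ?case using Suc.IH by simp
qed (simp add: power2_eq_square)

text \<open>If -1 is in A the first bound can fail: for A = {-1, -2, ..., -2^(N-1)} one has |AA| <=
  2|A|, but all tuples with a factor 0 on each side are solutions, and equal weights give at least
  N^(1 - 2/k), unbounded for k >= 3.\<close>

theorem theorem18:
  fixes A :: "rat set" and K :: int and k :: nat
  assumes "finite A"
    and "int (card (product_set A A)) \<le> K * int (card A)"
    and "k \<ge> 1"
  shows "(-1 \<notin> A \<longrightarrow> Lambda_const k (shift_one A) \<le> (8 * real k ^ 4) powi K)
    \<and> real (card (kfold_product_set k (shift_one A)))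
        \<ge> real (card A) ^ k / (8 * real k ^ 4) powi (int k * K)"
proof (cases "A = {}")
  case True
  have "(8 * real k ^ 4) powi K \<ge> 0" by simp
  then show ?thesis using True assms(3) by (auto simp: shift_one_def Lambda_const_def power_0_left)
next
  case False
  define M where "M = 8 * real k ^ 4"
  define n where "n = nat K"
  have k1: "real k \<ge> 1" using assms(3) by simp
  have k2: "(real k)\<^sup>2 \<ge> 1" and k4: "real k ^ 4 \<ge> 1" using k1 by (simp_all add: one_le_power)
  have M8: "M \<ge> 8" unfolding M_def using k4 by simp
  have cA: "card A > 0" using False assms(1) by (simp add: card_gt_0_iff)
  have "product_set A A \<noteq> {}" using False by (auto simp: product_set_def)
  then have "card (product_set A A) > 0" using finite_product_set assms(1) by (simp add: card_gt_0_iff)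
  then have "K * int (card A) > 0" using assms(2) by linarith
  then have K: "K \<ge> 1" using cA by (simp add: zero_less_mult_iff)
  then have Kn: "K = int n" and n1: "n \<ge> 1" by (auto simp: n_def)
  have pow1: "M powi K = M ^ n" unfolding Kn by simp
  have pow2: "M powi (int k * K) = (M ^ n) ^ k"
    unfolding Kn by (metis mult.commute of_nat_mult power_int_of_nat power_mult)
  define B where "B = shift_one A"
  have B: "B = (\<lambda>a. a + 1) ` A" by (auto simp: B_def shift_one_def)
  have finB: "finite B" "B \<noteq> {}" "card B = card A"
    using assms(1) False card_shift_one[of A] by (auto simp: B B_def[symmetric])
  have Mn: "M ^ n \<ge> 1" using M8 by (intro one_le_power) simp
  \<comment> \<open>For small A the right side is at least 1 because the product set is nonempty. No
    energy is involved, so this also covers sets containing -1.\<close>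
  have trivial_card: "real (card A) ^ k / (M ^ n) ^ k \<le> real (card (kfold_product_set k B))"
    if small: "real (card A) \<le> M ^ n"
  proof -
    have "kfold_product_set k B \<noteq> {}" using finB(2) by (auto simp: kfold_product_set_def)
    \<comment> \<open>Only finiteness is wanted; the constant is chosen to turn the assumption on
      the energy into an equality.\<close>
    moreover have "finite (kfold_product_set k B)"
      by (rule card_power_le_kfold_product_set(1)[OF assms(3) finB(1,2), of "(energy_norm k (\<lambda>b. b) (\<lambda>_. 1) B)\<^sup>2 / card B"])
        (use finB cA in simp)
    ultimately have "card (kfold_product_set k B) \<ge> 1"
      by (metis One_nat_def Suc_leI card_gt_0_iff)
    moreover have "real (card A) ^ k / (M ^ n) ^ k \<le> 1"
      using small Mn by (simp add: power_mono)
    ultimately show ?thesis by linarith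
  qed
  have "(-1 \<notin> A \<longrightarrow> Lambda_const k B \<le> M ^ n) \<and>
    real (card A) ^ k / (M ^ n) ^ k \<le> real (card (kfold_product_set k B))"
  proof (cases "card A \<le> (n + 1)\<^sup>2")
    case True
    have "real (card A) \<le> real (8 ^ n)"
      using True square_le_eight_power[OF n1] by (intro of_nat_mono) simp
    also have "\<dots> \<le> M ^ n" using power_mono[OF M8, of n] by simp
    finally have small: "real (card A) \<le> M ^ n" .
    have "Lambda_const k B \<le> M ^ n" if "-1 \<notin> A"
    proof (rule Lambda_const_le[OF assms(3) finB(1)])
      fix w :: "rat \<Rightarrow> real" assume w: "\<And>b. b \<in> B \<Longrightarrow> w b \<ge> 0"
      have "(energy_norm k (\<lambda>b. b) w B)\<^sup>2 \<le> real (card B) * (\<Sum>b\<in>B. (w b)\<^sup>2)"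
        by (rule energy_norm_bound_card[OF assms(3) finB(1) w]) (use that in \<open>auto simp: B add_eq_0_iff2\<close>)
      also have "\<dots> \<le> M ^ n * (\<Sum>b\<in>B. (w b)\<^sup>2)"
        using small finB(3) by (intro mult_right_mono sum_nonneg) auto
      finally show "(energy_norm k (\<lambda>b. b) w B)\<^sup>2 \<le> M ^ n * (\<Sum>b\<in>B. (w b)\<^sup>2)" .
    qed (use Mn in simp)
    then show ?thesis using trivial_card[OF small] by blast
  next
    case False
    then obtain T where T: "ratios_spanned (A - {0}) T" "card T < n"
      using small_doubling_rank[OF assms(1), of n] assms(2) Kn by auto
    define C where "C = 3 * (6 * (real k)\<^sup>2) ^ card T"
    have C0: "C \<ge> 0" by (simp add: C_def)
    \<comment> \<open>Here 2 * 3 <= M uses up the one power by which \<open>card T\<close> falls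
      short of n. The factor 2 is reserved for the removal of -1 from A.\<close>
    have C2: "2 * C \<le> M ^ n"
    proof -
      have "(real k)\<^sup>2 * 1 \<le> (real k)\<^sup>2 * (real k)\<^sup>2" using k2 by (intro mult_left_mono) auto
      then have "(real k)\<^sup>2 \<le> real k ^ 4" by (simp flip: power_add)
      then have "6 * (real k)\<^sup>2 \<le> M" unfolding M_def using k4 by simp
      then have "(6 * (real k)\<^sup>2) ^ card T \<le> M ^ card T" by (intro power_mono) auto
      then have "2 * C \<le> M * M ^ card T" unfolding C_def
        using mult_mono[of 6 M "(6 * (real k)\<^sup>2) ^ card T" "M ^ card T"] M8 by simp
      also have "\<dots> = M ^ Suc (card T)" by simp
      also have "\<dots> \<le> M ^ n" using T(2) M8 by (intro power_increasing) auto
      finally show ?thesis .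
    qed
    have "Lambda_const k B \<le> C" if "-1 \<notin> A"
      unfolding C_def B_def
      by (intro Lambda_const_le energy_norm_bound_shift_one assms(1,3) that T(1))
        (use finB in \<open>auto simp: B_def\<close>)
    moreover have "real (card A) ^ k / (M ^ n) ^ k \<le> real (card (kfold_product_set k B))"
    proof (cases "A - {-1} = {}")
      case True
      then have "A = {-1}" using \<open>A \<noteq> {}\<close> by blast
      then show ?thesis using Mn by (intro trivial_card) simp
    next
      case ne: False
      \<comment> \<open>Without -1 all shifted elements are nonzero and the energy bound applies. As
        A' is nonempty, |A| <= 2|A'|, and the resulting 2^k is absorbed into (2C)^k.\<close>
      define A' where "A' = A - {-1}"
      have A': "finite A'" "A' \<noteq> {}" "-1 \<notin> A'" using assms(1) ne by (auto simp: A'_def)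
      have T': "ratios_spanned (A' - {0}) T" using T(1) by (auto simp: ratios_spanned_def A'_def)
      define B' where "B' = shift_one A'"
      have B': "B' \<subseteq> B" "finite B'" "B' \<noteq> {}" "card B' = card A'"
        using A' card_shift_one[of A'] by (auto simp: B'_def B A'_def shift_one_def)
      have "(energy_norm k (\<lambda>b. b) (\<lambda>_. 1) B')\<^sup>2 \<le> C * real (card B')"
        using energy_norm_bound_shift_one[OF assms(3) A'(1,3) T', of "\<lambda>_. 1"] by (simp add: B'_def C_def)
      note * = card_power_le_kfold_product_set[OF assms(3) B'(2,3) this]
      have finK: "finite (kfold_product_set k B)"
        by (rule card_power_le_kfold_product_set(1)[OF assms(3) finB(1,2), of "(energy_norm k (\<lambda>b. b) (\<lambda>_. 1) B)\<^sup>2 / card B"])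
          (use finB cA in simp)
      have "kfold_product_set k B' \<subseteq> kfold_product_set k B"
        using B'(1) by (auto simp: kfold_product_set_def)
      then have le: "card (kfold_product_set k B') \<le> card (kfold_product_set k B)"
        by (rule card_mono[OF finK])
      have "card A \<le> card A' + 1" using assms(1) by (auto simp: A'_def card_Diff_singleton_if)
      moreover have "card A' > 0" using A' by (simp add: card_gt_0_iff)
      ultimately have "real (card A) \<le> 2 * real (card A')" by simp
      then have "real (card A) ^ k \<le> (2 * real (card A')) ^ k" by (intro power_mono) auto
      also have "\<dots> = 2 ^ k * real (card B') ^ k" using B'(4) by (simp add: power_mult_distrib)
      also have "\<dots> \<le> 2 ^ k * (C ^ k * real (card (kfold_product_set k B')))"
        using *(2) by (intro mult_left_mono) auto
      also have "\<dots> = (2 * C) ^ k * real (card (kfold_product_set k B'))" by (simp add: power_mult_distrib)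
      also have "\<dots> \<le> (M ^ n) ^ k * real (card (kfold_product_set k B))"
        using C0 C2 le Mn by (intro mult_mono power_mono) auto
      finally show ?thesis using Mn by (simp add: divide_simps mult_ac) 
    qed
    ultimately show ?thesis using C0 C2 by auto
  qed
  then show ?thesis unfolding M_def[symmetric] pow1 pow2 B_def[symmetric] by blast
qed

end
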